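(* Let $a\in H^\infty$, $a\not\equiv 0$. There is no point $\zeta_0\in\mathbb{T}$ such that every $f\in\mathscr{M}(\overline{a})$ can be analytically continued to some open neighborhood of $\zeta_0$.
   Context: $\mathbb{D}$ is the open unit disk, $\mathbb{T}$ the unit circle, $H^2$ the Hardy space of $\mathbb{D}$, $H^\infty$ the bounded analytic functions on $\mathbb{D}$. For $\varphi\in L^\infty(\mathbb{T})$, $T_\varphi f=P_+(\varphi f)$ for $f\in H^2$, where $P_+:L^2(\mathbb{T})\to H^2$ is the orthogonal projection. $\mathscr{M}(\overline{a}):=T_{\overline{a}}H^2$, viewed as a space of analytic functions on $\mathbb{D}$. *)

theory Defs
  imports "HOL-Complex_Analysis.Complex_Analysis"
begin

abbreviation unit_disk :: "complex set"
  where "unit_disk \<equiv> ball 0 1"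

text \<open>
  Functions on the disk are total functions on the complex plane extended by zero, so that
  equality of elements of the Hardy spaces is equality of functions on the disk.
\<close>

definition disk_analytic :: "(complex \<Rightarrow> complex) set"
  where "disk_analytic = {f. f holomorphic_on unit_disk \<and> (\<forall>z. z \<notin> unit_disk \<longrightarrow> f z = 0)}"

definition hardy_2 :: "(complex \<Rightarrow> complex) set"
  where "hardy_2 = {f \<in> disk_analytic.
    bdd_above ((\<lambda>r::real. (LINT t:{0..2*pi}|lebesgue. (cmod (f (of_real r * cis t)))\<^sup>2) / (2*pi))
      ` {0<..<1})}"

definition hardy_inf :: "(complex \<Rightarrow> complex) set"
  where "hardy_inf = {f \<in> disk_analytic. bounded (f ` unit_disk)}"

text \<open>
  The radial limit exists at almost every point of the circle for functions in the Hardy spaces;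
  at the remaining points the value is an unspecified constant.
\<close>

definition radial_boundary :: "(complex \<Rightarrow> complex) \<Rightarrow> complex \<Rightarrow> complex"
  where "radial_boundary f \<zeta> = Lim (at_left (1::real)) (\<lambda>r. f (of_real r * \<zeta>))"

text \<open>Inner product of \<open>L\<^sup>2\<close> of the circle with respect to normalised arc length.\<close>

definition circle_inner :: "(complex \<Rightarrow> complex) \<Rightarrow> (complex \<Rightarrow> complex) \<Rightarrow> complex"
  where "circle_inner g k =
    (LINT t:{0..2*pi}|lebesgue. g (cis t) * cnj (k (cis t))) / of_real (2*pi)"

text \<open>
  Orthogonal projection of \<open>L\<^sup>2\<close> of the circle onto the Hardy space, the latter being embedded
  by boundary values; the projection is returned as a function on the disk. It is meaningful
  only for square-integrable \<open>g\<close>.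
\<close>

definition riesz_projection :: "(complex \<Rightarrow> complex) \<Rightarrow> complex \<Rightarrow> complex"
  where "riesz_projection g = (THE h. h \<in> hardy_2 \<and>
    (\<forall>k\<in>hardy_2. circle_inner (\<lambda>\<zeta>. g \<zeta> - radial_boundary h \<zeta>) (radial_boundary k) = 0))"

definition toeplitz :: "(complex \<Rightarrow> complex) \<Rightarrow> (complex \<Rightarrow> complex) \<Rightarrow> complex \<Rightarrow> complex"
  where "toeplitz \<phi> f = riesz_projection (\<lambda>\<zeta>. \<phi> \<zeta> * radial_boundary f \<zeta>)"

definition toeplitz_range :: "(complex \<Rightarrow> complex) \<Rightarrow> (complex \<Rightarrow> complex) set"
  where "toeplitz_range \<phi> = toeplitz \<phi> ` hardy_2"

definition continues_analytically_near :: "(complex \<Rightarrow> complex) \<Rightarrow> complex \<Rightarrow> bool"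
  where "continues_analytically_near f \<zeta> \<longleftrightarrow>
    (\<exists>U F. open U \<and> \<zeta> \<in> U \<and> F holomorphic_on U \<and> (\<forall>z\<in>U \<inter> unit_disk. F z = f z))"

end

theory Submission
  imports Defs
begin

text \<open>
  The operator \<open>T\<close> with symbol \<open>cnj a\<close> maps the Szego kernel \<open>1 / (1 - cnj l * z)\<close> to \<open>cnj (a l)\<close> times itself.
  Choose points \<open>l n\<close> on the radius to \<open>\<zeta>\<^sub>0\<close>, tending to \<open>\<zeta>\<^sub>0\<close>, that are not zeros of \<open>a\<close>. A rapidly
  converging series of their kernels is then mapped to a similar series with nonzero coefficients,
  which is meromorphic off \<open>\<zeta>\<^sub>0\<close> with poles \<open>1 / cnj (l n)\<close> accumulating at \<open>\<zeta>\<^sub>0\<close>; by the identity theorem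
  it has no holomorphic continuation across \<open>\<zeta>\<^sub>0\<close>.

  The projection is defined through radial limits, so Fatou's theorem is needed: for \<open>G\<close> in the
  Hardy space, the primitive \<open>B\<close> of \<open>G\<close> is continuous on the closed disk and its boundary function is
  an indefinite integral, hence differentiable almost everywhere; wherever it is differentiable, \<open>G = B'\<close> has
  a radial limit.
\<close>

section \<open>Radial limits of derivatives\<close>

text \<open>A single kernel would not do: its only pole lies outside the closed disk, so it
  continues across the whole circle. Infinitely many poles clustering at
  \<open>\<zeta>\<^sub>0\<close> are the obstruction, and \<open>a (l n) \<noteq> 0\<close> keeps
  each of them a genuine pole after \<open>T\<close> has been applied. The kernels are eigenvectors
  because multiplication by \<open>a\<close> is the adjoint of \<open>T\<close>: against a test
  function \<open>k\<close> the question becomes the value of \<open>a * k\<close> at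
  \<open>l\<close>. The projection is a definite description that demands orthogonality to every
  \<open>k\<close> in the Hardy space. Hence the reproducing formula is proved for the boundary
  values of arbitrary elements, and the boundary function of \<open>a * k\<close> has to be the
  product of the two boundary functions almost everywhere. This is the point where existence of the
  radial limits is indispensable: where a limit fails to exist, \<open>radial_boundary\<close> is an
  unspecified value that respects no algebra. Integrability has to accompany each step as well,
  since \<open>circle_inner\<close> is built on an integral that defaults to 0.\<close>

lemma has_contour_integral_unit_circle:
  "(f has_contour_integral I) (circlepath 0 1) \<longleftrightarrow>
   ((\<lambda>x. f (exp (2 * of_real pi * \<i> * of_real x)) * (2 * pi * \<i> * exp (2 * of_real pi * \<i> * of_real x)))
     has_integral I) {0..1}"
  unfolding has_contour_integral vector_derivative_circlepath by (simp add: circlepath)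

text \<open>On the circle \<open>w - r\<close> and \<open>1 - r * w\<close> have the same modulus
  \<open>q\<close>, and \<open>cmod (w - 1)\<close> is at most \<open>2 * q\<close>. Near 1 the
  factors \<open>R\<close> and \<open>1 - w\<^sup>2\<close> are at most
  \<open>2 * \<epsilon> * q\<close> and \<open>4 * q\<close>; they cancel two of the four powers of
  \<open>q\<close> and leave a Poisson kernel with constant 8. Away from 1, \<open>q\<close> is at
  least \<open>\<delta> / 2\<close>, and 64 is 4 times 16.\<close>

lemma fatou_kernel_bound:
  fixes r :: real and w R :: complex
  assumes r: "0 < r" "r < 1" and w: "cmod w = 1" and d: "0 < \<delta>" "0 < \<epsilon>" and M: "cmod R \<le> M"
    and o: "cmod (w - 1) < \<delta> \<Longrightarrow> cmod R \<le> \<epsilon> * cmod (w - 1)"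
  shows "cmod (R * ((1 - r\<^sup>2) * (1 - w\<^sup>2)) / ((w - r)\<^sup>2 * (1 - r * w)\<^sup>2))
    \<le> 8 * \<epsilon> * ((1 - r\<^sup>2) / (cmod (1 - r * w))\<^sup>2) + 64 * M * (1 - r\<^sup>2) / \<delta> ^ 4"
proof -
  define q where "q = cmod (1 - r * w)"
  have ww: "w * cnj w = 1" using w by (simp add: complex_norm_square[symmetric])
  have "w - r = w * cnj (1 - r * w)"
    using ww by (simp add: algebra_simps)
  hence wr: "cmod (w - r) = q" using w by (simp add: norm_mult q_def del: complex_cnj_diff)
  have q1: "1 - r \<le> q"
  proof -
    have "cmod 1 - cmod (r * w) \<le> q" unfolding q_def by (rule norm_triangle_ineq2)
    thus ?thesis using w r by (simp add: norm_mult)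
  qed
  have q0: "0 < q" using q1 r by simp
  have w1q: "cmod (w - 1) \<le> 2 * q"
  proof -
    have "w - 1 = (r * w - 1) + (1 - r) * w" by (simp add: algebra_simps)
    hence "cmod (w - 1) \<le> cmod (r * w - 1) + cmod ((1 - r) * w)" by (metis norm_triangle_ineq of_real_1 of_real_diff)
    also have "cmod ((1 - r) * w) = 1 - r"
      using w r by (simp add: norm_mult) (metis abs_of_pos diff_gt_0_iff_gt norm_of_real of_real_1 of_real_diff)
    finally show ?thesis using q1 by (simp add: q_def norm_minus_commute)
  qed
  have w2: "cmod (1 - w\<^sup>2) \<le> 2 * cmod (w - 1)"
  proof -
    have "1 - w\<^sup>2 = (1 + w) * (1 - w)" by (simp add: algebra_simps power2_eq_square)
    hence "cmod (1 - w\<^sup>2) = cmod (1 + w) * cmod (w - 1)" by (simp add: norm_mult norm_minus_commute)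
    also have "cmod (1 + w) \<le> 2" using norm_triangle_ineq[of 1 w] w by simp
    hence "cmod (1 + w) * cmod (w - 1) \<le> 2 * cmod (w - 1)" by (intro mult_right_mono) auto
    finally show ?thesis .
  qed
  have r2: "0 < 1 - r\<^sup>2" using r by (simp add: power_less_one_iff abs_square_less_1)
  have "cmod (1 - (complex_of_real r)\<^sup>2) = 1 - r\<^sup>2"
    using r2 by (metis abs_of_pos norm_of_real of_real_1 of_real_diff of_real_power)
  moreover have q4: "q ^ 4 = q\<^sup>2 * q\<^sup>2" by (simp flip: power_add)
  ultimately have eq: "cmod (R * ((1 - r\<^sup>2) * (1 - w\<^sup>2)) / ((w - r)\<^sup>2 * (1 - r * w)\<^sup>2))
     = cmod R * cmod (1 - w\<^sup>2) * (1 - r\<^sup>2) / q ^ 4"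
    unfolding q4 by (simp add: norm_mult norm_divide norm_power wr flip: q_def)
  have M0: "0 \<le> M" using M norm_ge_zero order_trans by blast
  show ?thesis
  proof (cases "cmod (w - 1) < \<delta>")
    case True
    have "cmod R * cmod (1 - w\<^sup>2) \<le> (\<epsilon> * (2 * q)) * (2 * (2 * q))"
      using o[OF True] w1q w2 d q0
      by (intro mult_mono) (auto intro: order_trans[OF o[OF True]])
    hence "cmod R * cmod (1 - w\<^sup>2) * (1 - r\<^sup>2) / q ^ 4 \<le> (\<epsilon> * (2 * q)) * (2 * (2 * q)) * (1 - r\<^sup>2) / q ^ 4"
      using r2 q0 by (intro divide_right_mono mult_right_mono) auto
    also have "\<dots> = 8 * \<epsilon> * ((1 - r\<^sup>2) / q\<^sup>2)"
      using q0 by (simp add: field_simps power2_eq_square power4_eq_xxxx)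
    also have "\<dots> \<le> 8 * \<epsilon> * ((1 - r\<^sup>2) / q\<^sup>2) + 64 * M * (1 - r\<^sup>2) / \<delta> ^ 4"
      using M0 r2 d by simp
    finally show ?thesis unfolding eq q_def .
  next
    case False
    have "\<delta> \<le> 2 * q" using False w1q by simp
    hence "\<delta> ^ 4 \<le> (2 * q) ^ 4" using d by (intro power_mono) auto
    hence dq: "\<delta> ^ 4 / 16 \<le> q ^ 4" by (simp add: power_mult_distrib)
    have "cmod (1 - w\<^sup>2) \<le> 4"
      using norm_triangle_ineq4[of 1 "w\<^sup>2"] w by (simp add: norm_power)
    hence "cmod R * cmod (1 - w\<^sup>2) \<le> M * 4" using M M0 by (intro mult_mono) auto
    hence "cmod R * cmod (1 - w\<^sup>2) * (1 - r\<^sup>2) / q ^ 4 \<le> M * 4 * (1 - r\<^sup>2) / (\<delta> ^ 4 / 16)"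
      using r2 q0 dq M0 d by (intro frac_le mult_right_mono) auto
    also have "\<dots> = 64 * M * (1 - r\<^sup>2) / \<delta> ^ 4" by simp
    also have "\<dots> \<le> 8 * \<epsilon> * ((1 - r\<^sup>2) / q\<^sup>2) + 64 * M * (1 - r\<^sup>2) / \<delta> ^ 4"
      using d r2 by simp
    finally show ?thesis unfolding eq q_def .
  qed
qed

lemma one_minus_mult_nonzero:
  fixes r :: real and u :: complex
  assumes "0 < r" "r < 1" "cmod u \<le> 1"
  shows "1 - r * u \<noteq> 0"
proof
  assume "1 - r * u = 0"
  hence "cmod (r * u) = 1" by (metis eq_iff_diff_eq_0 norm_one)
  moreover have "r * cmod u \<le> r * 1" using assms by (intro mult_left_mono) auto
  ultimately show False using assms by (simp add: norm_mult)
qed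

text \<open>For \<open>u\<close> on the circle, \<open>cnj (1 - r * u)\<close> is
  \<open>(u - r) / u\<close>. The Poisson kernel thereby turns into the Cauchy integrand of the
  function \<open>1 / (1 - r * u)\<close> at the point \<open>r\<close>, where that function has the
  value \<open>1 / (1 - r\<^sup>2)\<close>.\<close>

lemma poisson_mass:
  fixes r :: real
  assumes r: "0 < r" "r < 1"
  shows "((\<lambda>x. (1 - r\<^sup>2) / (cmod (1 - r * exp (2 * of_real pi * \<i> * of_real x)))\<^sup>2) has_integral 1) {0..1}"
proof -
  let ?w = "\<lambda>x::real. exp (2 * of_real pi * \<i> * of_real x)"
  note nz = one_minus_mult_nonzero[OF r]
  have "((\<lambda>u. (1 / (1 - r * u)) / (u - r)) has_contour_integral
      2 * of_real pi * \<i> * (1 / (1 - complex_of_real r * r))) (circlepath 0 1)"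
    by (rule Cauchy_integral_circlepath)
       (use r nz in \<open>auto intro!: continuous_intros holomorphic_intros\<close>)
  hence "((\<lambda>x. (1 / (1 - r * ?w x)) / (?w x - r) * (2 * pi * \<i> * ?w x))
     has_integral 2 * of_real pi * \<i> * (1 / (1 - complex_of_real r * r))) {0..1}"
    unfolding has_contour_integral_unit_circle .
  hence "((\<lambda>x. (1 - complex_of_real r * r) / (2 * of_real pi * \<i>) * ((1 / (1 - r * ?w x)) / (?w x - r) * (2 * pi * \<i> * ?w x)))
     has_integral (1 - complex_of_real r * r) / (2 * of_real pi * \<i>) * (2 * of_real pi * \<i> * (1 / (1 - complex_of_real r * r)))) {0..1}"
    by (rule has_integral_mult_right)
  also have "(1 - complex_of_real r * r) / (2 * of_real pi * \<i>) * (2 * of_real pi * \<i> * (1 / (1 - complex_of_real r * r))) = complex_of_real 1"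
    using nz[of r] r by (simp add: divide_simps)
  finally have "((\<lambda>x. complex_of_real ((1 - r\<^sup>2) / (cmod (1 - r * ?w x))\<^sup>2)) has_integral complex_of_real 1) {0..1}"
  proof (rule has_integral_eq[rotated])
    fix x :: real
    define w where "w = ?w x"
    have w: "cmod w = 1" unfolding w_def by (simp add: norm_exp_eq_Re)
    have ww: "w * cnj w = 1" using w by (simp add: complex_norm_square[symmetric])
    have wr: "w - r = w * cnj (1 - r * w)"
      using ww by (simp add: algebra_simps)
    have w0: "w \<noteq> 0" using w by auto
    have "(1 / (1 - r * w)) / (w - r) * (2 * pi * \<i> * w) = 2 * pi * \<i> / ((1 - r * w) * cnj (1 - r * w))"
      unfolding wr using w0 by (simp add: divide_simps del: complex_cnj_diff)
    also have "(1 - r * w) * cnj (1 - r * w) = of_real ((cmod (1 - r * w))\<^sup>2)"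
      by (metis complex_norm_square)
    finally show "(1 - complex_of_real r * r) / (2 * of_real pi * \<i>) * ((1 / (1 - r * ?w x)) / (?w x - r) * (2 * pi * \<i> * ?w x))
       = complex_of_real ((1 - r\<^sup>2) / (cmod (1 - r * ?w x))\<^sup>2)"
      unfolding w_def by (simp add: power2_eq_square)
  qed
  from has_integral_Re[OF this] show ?thesis by simp
qed

text \<open>
  Cauchy's formula alone has the kernel \<open>1 / (u - r)\<^sup>2\<close>, against which an \<open>o(\<bar>u - 1\<bar>)\<close> function may contribute
  a logarithmically divergent amount. Subtracting \<open>1 / (1 - r * u)\<^sup>2\<close>, whose contribution vanishes by Cauchy's
  theorem, turns it into the tangential derivative of the Poisson kernel, which gains the factor \<open>1 - u\<^sup>2\<close>.
\<close>

lemma fatou_derivative_zero: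
  fixes R :: "complex \<Rightarrow> complex"
  assumes cont: "continuous_on (cball 0 1) R" and hol: "R holomorphic_on ball 0 1"
    and o: "\<And>\<epsilon>. \<epsilon> > 0 \<Longrightarrow> \<exists>\<delta>>0. \<forall>w. cmod w = 1 \<longrightarrow> cmod (w - 1) < \<delta> \<longrightarrow> cmod (R w) \<le> \<epsilon> * cmod (w - 1)"
  shows "((\<lambda>r::real. deriv R (of_real r)) \<longlongrightarrow> 0) (at_left 1)"
proof -
  let ?w = "\<lambda>x::real. exp (2 * of_real pi * \<i> * of_real x)"
  obtain M where M: "\<And>w. w \<in> cball 0 1 \<Longrightarrow> cmod (R w) \<le> M"
    using compact_imp_bounded[OF compact_continuous_image[OF cont compact_cball]]
    unfolding bounded_iff by (metis image_eqI)
  have bound: "cmod (deriv R r) \<le> 8 * \<epsilon> + 64 * M * (1 - r\<^sup>2) / \<delta> ^ 4"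
    if r: "0 < r" "r < 1" and d: "0 < \<delta>" "0 < \<epsilon>"
      and o: "\<forall>w. cmod w = 1 \<longrightarrow> cmod (w - 1) < \<delta> \<longrightarrow> cmod (R w) \<le> \<epsilon> * cmod (w - 1)"
    for r \<delta> \<epsilon> :: real
  proof -
    note nz = one_minus_mult_nonzero[OF r]
    have 1: "((\<lambda>u. R u / (u - r)\<^sup>2) has_contour_integral 2 * pi * \<i> * deriv R r) (circlepath 0 1)"
      using Cauchy_has_contour_integral_higher_derivative_circlepath[OF cont hol, of r 1] r
      by (simp add: numeral_2_eq_2)
    have 2: "((\<lambda>u. R u / (1 - r * u)\<^sup>2) has_contour_integral 0) (circlepath 0 1)"
      by (rule Cauchy_theorem_disc[of "{}" 0 1])
         (use nz in \<open>auto intro!: continuous_intros cont holomorphic_on_imp_differentiable_at[of _ "ball 0 1"] holomorphic_intros hol\<close>)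
    have "((\<lambda>u. R u / (u - r)\<^sup>2 - R u / (1 - r * u)\<^sup>2) has_contour_integral 2 * pi * \<i> * deriv R r) (circlepath 0 1)"
      using has_contour_integral_diff[OF 1 2] by simp
    hence "((\<lambda>u. R u * ((1 - r\<^sup>2) * (1 - u\<^sup>2)) / ((u - r)\<^sup>2 * (1 - r * u)\<^sup>2)) has_contour_integral 2 * pi * \<i> * deriv R r) (circlepath 0 1)"
    proof (rule has_contour_integral_eq)
      fix u assume "u \<in> path_image (circlepath 0 1)"
      hence u: "cmod u = 1" by simp
      have a: "1 - r * u \<noteq> 0" using nz u by simp
      have b: "u - r \<noteq> 0" using u r by auto
      have "R u / (u - r)\<^sup>2 - R u / (1 - r * u)\<^sup>2 = R u * ((1 - r * u)\<^sup>2 - (u - r)\<^sup>2) / ((u - r)\<^sup>2 * (1 - r * u)\<^sup>2)"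
        using a b by (simp add: field_simps)
      also have "(1 - r * u)\<^sup>2 - (u - r)\<^sup>2 = (1 - r\<^sup>2) * (1 - u\<^sup>2)"
        by (simp add: algebra_simps power2_eq_square)
      finally show "R u / (u - r)\<^sup>2 - R u / (1 - r * u)\<^sup>2 = R u * ((1 - r\<^sup>2) * (1 - u\<^sup>2)) / ((u - r)\<^sup>2 * (1 - r * u)\<^sup>2)" .
    qed
    hence I: "((\<lambda>x. R (?w x) * ((1 - r\<^sup>2) * (1 - (?w x)\<^sup>2)) / ((?w x - r)\<^sup>2 * (1 - r * ?w x)\<^sup>2) * (2 * pi * \<i> * ?w x))
       has_integral 2 * pi * \<i> * deriv R r) {0..1}"
      unfolding has_contour_integral_unit_circle .
    have J: "((\<lambda>x. 2 * pi * (8 * \<epsilon> * ((1 - r\<^sup>2) / (cmod (1 - r * ?w x))\<^sup>2) + 64 * M * (1 - r\<^sup>2) / \<delta> ^ 4))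
        has_integral 2 * pi * (8 * \<epsilon> * 1 + 64 * M * (1 - r\<^sup>2) / \<delta> ^ 4)) {0..1}"
      using has_integral_const_real[of "64 * M * (1 - r\<^sup>2) / \<delta> ^ 4" 0 1]
      by (intro has_integral_mult_right has_integral_add poisson_mass r) simp
    have "cmod (2 * pi * \<i> * deriv R r) \<le> 2 * pi * (8 * \<epsilon> * 1 + 64 * M * (1 - r\<^sup>2) / \<delta> ^ 4)"
      unfolding integral_unique[OF I, symmetric] integral_unique[OF J, symmetric]
    proof (rule integral_norm_bound_integral[OF has_integral_integrable[OF I] has_integral_integrable[OF J]])
      fix x :: real
      have w: "cmod (?w x) = 1" by (simp add: norm_exp_eq_Re)
      show "cmod (R (?w x) * ((1 - r\<^sup>2) * (1 - (?w x)\<^sup>2)) / ((?w x - r)\<^sup>2 * (1 - r * ?w x)\<^sup>2) * (2 * pi * \<i> * ?w x))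
        \<le> 2 * pi * (8 * \<epsilon> * ((1 - r\<^sup>2) / (cmod (1 - r * ?w x))\<^sup>2) + 64 * M * (1 - r\<^sup>2) / \<delta> ^ 4)"
        (is "cmod (?X * ?Y) \<le> _ * ?Z")
      proof -
        have "cmod ?Y = 2 * pi" unfolding norm_mult w by simp
        hence "cmod (?X * ?Y) = 2 * pi * cmod ?X"
          unfolding norm_mult[of ?X ?Y] by (metis mult.commute)
        also have "\<dots> \<le> 2 * pi * ?Z"
          using fatou_kernel_bound[OF r w d M, of "?w x"] o w by (intro mult_left_mono) auto
        finally show ?thesis .
      qed
    qed
    thus ?thesis by (simp add: norm_mult)
  qed
  show ?thesis
  proof (rule tendstoI)
    fix e :: real assume e: "e > 0"
    \<comment> \<open>As \<open>r\<close> tends to 1 the bound tends to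
      \<open>8 * \<epsilon>\<close>, which is then \<open>e / 2\<close> and so strictly below
      \<open>e\<close>.\<close>
    define \<epsilon> where "\<epsilon> = e / 16"
    have eps: "\<epsilon> > 0" using e by (simp add: \<epsilon>_def)
    then obtain \<delta> where d: "\<delta> > 0" "\<forall>w. cmod w = 1 \<longrightarrow> cmod (w - 1) < \<delta> \<longrightarrow> cmod (R w) \<le> \<epsilon> * cmod (w - 1)"
      using o by blast
    have "((\<lambda>r. 8 * \<epsilon> + 64 * M * (1 - r\<^sup>2) / \<delta> ^ 4) \<longlongrightarrow> 8 * \<epsilon> + 64 * M * (1 - 1\<^sup>2) / \<delta> ^ 4) (at_left (1::real))"
      using d by (intro tendsto_intros) auto
    hence "\<forall>\<^sub>F r in at_left (1::real). 8 * \<epsilon> + 64 * M * (1 - r\<^sup>2) / \<delta> ^ 4 < e"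
      by (rule order_tendstoD) (use e in \<open>simp add: \<epsilon>_def\<close>)
    moreover have "\<forall>\<^sub>F r in at_left (1::real). r \<in> {0<..<1}"
      by (rule eventually_at_left_real) simp
    ultimately show "\<forall>\<^sub>F r in at_left 1. dist (deriv R (of_real r)) 0 < e"
    proof eventually_elim
      case (elim r)
      thus ?case using bound[of r, OF _ _ d(1) eps d(2)] by simp
    qed
  qed
qed

section \<open>Fourier series of Hardy space functions\<close>

lemma has_integral_circle_monomials:
  "((\<lambda>t. cis t ^ n * cnj (cis t ^ m)) has_integral (if n = m then of_real (2 * pi) else 0)) {0..2 * pi}"
proof (cases "n = m")
  case True
  have "cis t ^ m * cnj (cis t ^ m) = 1" for t
    by (metis complex_norm_square norm_cis norm_power of_real_1 power_one)
  thus ?thesis using True has_integral_const_real[of "1::complex" 0 "2 * pi"]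
    by (simp add: scaleR_conv_of_real)
next
  case False
  define k where "k = real n - real m"
  have k: "k \<noteq> 0" using False by (simp add: k_def)
  have eq: "cis t ^ n * cnj (cis t ^ m) = exp (\<i> * k * t)" for t
  proof -
    have "cis t ^ n * cnj (cis t ^ m) = cis (real n * t) * cis (- (real m * t))"
      by (simp only: Complex.DeMoivre cis_cnj)
    also have "\<dots> = cis (k * t)" by (simp add: cis_mult k_def algebra_simps)
    finally show ?thesis by (simp add: cis_conv_exp mult.assoc)
  qed
  have "((\<lambda>t. exp (\<i> * k * complex_of_real t)) has_integral
      exp (\<i> * k * complex_of_real (2 * pi)) / (\<i> * k) - exp (\<i> * k * complex_of_real 0) / (\<i> * k)) {0..2 * pi}"
    by (rule fundamental_theorem_of_calculus)
       (use k in \<open>auto intro!: derivative_eq_intros has_vector_derivative_real_field\<close>)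
  moreover have "exp (\<i> * k * complex_of_real (2 * pi)) = 1"
  proof -
    have "k \<in> \<int>" by (simp add: k_def)
    thus ?thesis using cis_multiple_2pi[of k] by (simp add: cis_conv_exp mult_ac)
  qed
  ultimately show ?thesis unfolding eq using False by simp
qed

lemma has_integral_parseval_finite:
  assumes "finite S"
  shows "((\<lambda>t. (cmod (\<Sum>n\<in>S. c n * cis t ^ n))\<^sup>2) has_integral 2 * pi * (\<Sum>n\<in>S. (cmod (c n))\<^sup>2)) {0..2 * pi}"
proof -
  have "((\<lambda>t. \<Sum>n\<in>S. \<Sum>m\<in>S. c n * cnj (c m) * (cis t ^ n * cnj (cis t ^ m))) has_integral
     (\<Sum>n\<in>S. \<Sum>m\<in>S. c n * cnj (c m) * (if n = m then of_real (2 * pi) else 0))) {0..2 * pi}"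
    by (intro has_integral_sum assms has_integral_mult_right has_integral_circle_monomials)
  also have "(\<Sum>n\<in>S. \<Sum>m\<in>S. c n * cnj (c m) * (if n = m then of_real (2 * pi) else 0))
     = complex_of_real (2 * pi * (\<Sum>n\<in>S. (cmod (c n))\<^sup>2))"
  proof -
    have "(\<Sum>m\<in>S. c n * cnj (c m) * (if n = m then of_real (2 * pi) else 0)) = of_real (2 * pi * (cmod (c n))\<^sup>2)"
      if "n \<in> S" for n
    proof -
      have "(\<Sum>m\<in>S. c n * cnj (c m) * (if n = m then of_real (2 * pi) else 0))
         = (\<Sum>m\<in>S. if n = m then c n * cnj (c m) * of_real (2 * pi) else 0)"
        by (intro sum.cong) auto
      also have "\<dots> = (c n * cnj (c n)) * of_real (2 * pi)" using that assms by (simp add: sum.delta)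
      also have "\<dots> = of_real (2 * pi * (cmod (c n))\<^sup>2)" unfolding complex_norm_square[symmetric] by simp
      finally show ?thesis .
    qed
    thus ?thesis by (simp add: sum_distrib_left cong: sum.cong)
  qed
  also have "(\<lambda>t. \<Sum>n\<in>S. \<Sum>m\<in>S. c n * cnj (c m) * (cis t ^ n * cnj (cis t ^ m)))
     = (\<lambda>t. complex_of_real ((cmod (\<Sum>n\<in>S. c n * cis t ^ n))\<^sup>2))"
    unfolding complex_norm_square cnj_sum sum_product
    by (intro ext sum.cong refl) (simp add: mult_ac)
  finally have "((\<lambda>t. complex_of_real ((cmod (\<Sum>n\<in>S. c n * cis t ^ n))\<^sup>2)) has_integral
      complex_of_real (2 * pi * (\<Sum>n\<in>S. (cmod (c n))\<^sup>2))) {0..2 * pi}" .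
  from has_integral_Re[OF this] show ?thesis unfolding Re_complex_of_real .
qed

lemma taylor_sums:
  assumes "G holomorphic_on unit_disk" "z \<in> unit_disk"
  shows "(\<lambda>n. (deriv ^^ n) G 0 / fact n * z ^ n) sums G z"
  using holomorphic_power_series[OF assms] by simp

lemma taylor_abs_summable:
  assumes "G holomorphic_on unit_disk" "cmod z < 1"
  shows "summable (\<lambda>n. cmod ((deriv ^^ n) G 0 / fact n * z ^ n))"
proof -
  obtain s where s: "cmod z < s" "s < 1" using assms dense by blast
  hence "cmod (complex_of_real s) < 1" by (smt (verit) norm_ge_zero norm_of_real)
  hence "summable (\<lambda>n. (deriv ^^ n) G 0 / fact n * (complex_of_real s) ^ n)"
    using taylor_sums[OF assms(1), of "of_real s"] by (auto simp: sums_iff)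
  thus ?thesis by (rule powser_insidea) (use s in \<open>smt (verit) norm_ge_zero norm_of_real\<close>)
qed

lemma circle_mean_integrable:
  assumes "f holomorphic_on unit_disk" "0 < r" "r < 1"
  shows "(\<lambda>t. (cmod (f (of_real r * cis t)))\<^sup>2) absolutely_integrable_on {0..2 * pi}"
  using assms
  by (intro absolutely_integrable_continuous_real continuous_intros
      continuous_on_compose2[OF holomorphic_on_imp_continuous_on[OF assms(1)]]) (auto simp: norm_mult)

text \<open>On a circle inside the disk the Taylor series is dominated by a convergent series of
  constants, so Parseval's identity for the partial sums passes to the limit by dominated
  convergence. The integrals of the longer partial sums all exceed the sum of the first
  \<open>N\<close> terms.\<close>

lemma bessel_on_circle:
  assumes G: "G holomorphic_on unit_disk" and r: "0 < r" "r < 1"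
  shows "2 * pi * (\<Sum>n<N. (cmod ((deriv ^^ n) G 0 / fact n * of_real r ^ n))\<^sup>2)
    \<le> (LINT t:{0..2*pi}|lebesgue. (cmod (G (of_real r * cis t)))\<^sup>2)"
proof -
  define c where "c n = (deriv ^^ n) G 0 / fact n * of_real r ^ n" for n
  have in_ball: "of_real r * cis t \<in> unit_disk" for t using r by (simp add: norm_mult)
  have summ: "summable (\<lambda>n. cmod (c n))"
    unfolding c_def using r by (intro taylor_abs_summable G) simp
  have sums: "(\<lambda>n. c n * cis t ^ n) sums G (of_real r * cis t)" for t
    using taylor_sums[OF G in_ball[of t]] by (simp add: c_def power_mult_distrib mult_ac)
  define S where "S = (\<lambda>M t. (cmod (\<Sum>n<M. c n * cis t ^ n))\<^sup>2)"
  have S: "(S M has_integral 2 * pi * (\<Sum>n<M. (cmod (c n))\<^sup>2)) {0..2 * pi}" for M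
    unfolding S_def by (rule has_integral_parseval_finite) simp
  have "(\<lambda>M. integral {0..2 * pi} (S M)) \<longlonglongrightarrow> integral {0..2 * pi} (\<lambda>t. (cmod (G (of_real r * cis t)))\<^sup>2)"
  proof (rule dominated_convergence(2))
    show "S M integrable_on {0..2 * pi}" for M using S by blast
    show "(\<lambda>_. (\<Sum>n. cmod (c n))\<^sup>2) integrable_on {0..2 * pi}" by (rule integrable_const_ivl)
    fix t :: real
    show "norm (S M t) \<le> (\<Sum>n. cmod (c n))\<^sup>2" for M
    proof -
      have "cmod (\<Sum>n<M. c n * cis t ^ n) \<le> (\<Sum>n<M. cmod (c n))"
        by (rule order_trans[OF norm_sum]) (simp add: norm_mult norm_power)
      also have "\<dots> \<le> (\<Sum>n. cmod (c n))" by (rule sum_le_suminf[OF summ]) auto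
      finally show ?thesis unfolding S_def by (simp add: power_mono)
    qed
    show "(\<lambda>M. S M t) \<longlonglongrightarrow> (cmod (G (of_real r * cis t)))\<^sup>2"
      unfolding S_def using sums[of t, unfolded sums_def] by (intro tendsto_intros)
  qed
  moreover have "2 * pi * (\<Sum>n<N. (cmod (c n))\<^sup>2) \<le> integral {0..2 * pi} (S M)" if "M \<ge> N" for M
    unfolding integral_unique[OF S] using that by (intro mult_left_mono sum_mono2) auto
  ultimately have "2 * pi * (\<Sum>n<N. (cmod (c n))\<^sup>2) \<le> integral {0..2 * pi} (\<lambda>t. (cmod (G (of_real r * cis t)))\<^sup>2)"
    by (intro LIMSEQ_le_const) auto
  also have "\<dots> = (LINT t:{0..2*pi}|lebesgue. (cmod (G (of_real r * cis t)))\<^sup>2)"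
    by (rule set_lebesgue_integral_eq_integral(2)[OF circle_mean_integrable[OF G r], symmetric])
  finally show ?thesis unfolding c_def .
qed

text \<open>With the number of terms fixed, the left side of Bessel's inequality is continuous in
  \<open>r\<close>, so the bound \<open>C\<close> survives the limit at 1. It does not depend on
  \<open>N\<close>, which gives summability.\<close>

lemma hardy_2_coeffs_summable:
  assumes "G \<in> hardy_2"
  shows "summable (\<lambda>n. (cmod ((deriv ^^ n) G 0 / fact n))\<^sup>2)"
proof -
  define g where "g n = (deriv ^^ n) G 0 / fact n" for n
  have hol: "G holomorphic_on unit_disk" using assms by (simp add: hardy_2_def disk_analytic_def)
  obtain C where C: "\<forall>r\<in>{0<..<1}. (LINT t:{0..2*pi}|lebesgue. (cmod (G (of_real r * cis t)))\<^sup>2) / (2*pi) \<le> C"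
    using assms unfolding hardy_2_def bdd_above_def mem_Collect_eq ball_simps by (elim conjE exE)
  have "(\<Sum>n<N. (cmod (g n))\<^sup>2) \<le> C" for N
  proof -
    have "((\<lambda>r. \<Sum>n<N. (cmod (g n * of_real r ^ n))\<^sup>2) \<longlongrightarrow> (\<Sum>n<N. (cmod (g n * of_real 1 ^ n))\<^sup>2)) (at_left (1::real))"
      by (intro tendsto_intros)
    moreover have "\<forall>\<^sub>F r in at_left (1::real). r \<in> {0<..<1}"
      by (rule eventually_at_left_real) simp
    hence "\<forall>\<^sub>F r in at_left (1::real). (\<Sum>n<N. (cmod (g n * of_real r ^ n))\<^sup>2) \<le> C"
    proof eventually_elim
      case (elim r)
      hence "(LINT t:{0..2*pi}|lebesgue. (cmod (G (of_real r * cis t)))\<^sup>2) \<le> C * (2 * pi)"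
        using C[rule_format, OF elim] by (subst (asm) pos_divide_le_eq) simp_all
      moreover have "0 < r" "r < 1" using elim by auto
      ultimately have "2 * pi * (\<Sum>n<N. (cmod (g n * of_real r ^ n))\<^sup>2) \<le> C * (2 * pi)"
        unfolding g_def using bessel_on_circle[OF hol, of r N] by linarith
      thus ?case by simp
    qed
    ultimately have "(\<Sum>n<N. (cmod (g n * of_real 1 ^ n))\<^sup>2) \<le> C"
      by (rule tendsto_upperbound) simp
    thus ?thesis by simp
  qed
  thus ?thesis unfolding g_def[symmetric]
    by (intro bounded_imp_summable[of _ C]) (auto simp flip: lessThan_Suc_atMost simp del: sum.lessThan_Suc)
qed

section \<open>A Riesz-Fischer theorem for Taylor coefficients\<close>

text \<open>By Tonelli the sum of the norms has a finite integral, so it is finite almost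
  everywhere. This supplies the pointwise hypothesis of \<open>integrable_suminf\<close> and
  \<open>sums_integral\<close>.\<close>

lemma integrable_suminf_AE_summable:
  fixes f :: "nat \<Rightarrow> 'a \<Rightarrow> 'b :: {banach, second_countable_topology}"
  assumes int: "\<And>i. integrable M (f i)" and sums: "summable (\<lambda>i. \<integral>x. norm (f i x) \<partial>M)"
  shows "AE x in M. summable (\<lambda>i. norm (f i x))"
proof -
  have meas [measurable]: "f i \<in> borel_measurable M" for i using int by auto
  have "(\<integral>\<^sup>+x. (\<Sum>i. ennreal (norm (f i x))) \<partial>M) = (\<Sum>i. \<integral>\<^sup>+x. ennreal (norm (f i x)) \<partial>M)"
    by (rule nn_integral_suminf) simp
  also have "\<dots> = (\<Sum>i. ennreal (\<integral>x. norm (f i x) \<partial>M))"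
    by (intro suminf_cong nn_integral_eq_integral integrable_norm int) auto
  also have "\<dots> = ennreal (\<Sum>i. \<integral>x. norm (f i x) \<partial>M)"
    by (intro suminf_ennreal2 sums) simp
  finally have fin: "(\<integral>\<^sup>+x. (\<Sum>i. ennreal (norm (f i x))) \<partial>M) \<noteq> \<infinity>" by simp
  have "AE x in M. (\<Sum>i. ennreal (norm (f i x))) \<noteq> \<infinity>"
    by (rule nn_integral_PInf_AE[OF _ fin]) measurable
  thus ?thesis
  proof eventually_elim
    case (elim x)
    thus ?case by (intro summable_suminf_not_top) simp_all
  qed
qed

text \<open>The rate 1/4 for squares corresponds to the rate 1/2 for the L^1 norms of the blocks,
  which makes those norms summable. The 1 in \<open>1 + suminf u\<close> keeps the bound positive
  even for \<open>u = 0\<close>, as the Cauchy criterion requires.\<close>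

lemma summable_block_tails:
  fixes u :: "nat \<Rightarrow> real"
  assumes "summable u" and nonneg: "\<And>n. 0 \<le> u n"
  obtains N :: "nat \<Rightarrow> nat" where "N 0 = 0" "strict_mono N"
    "\<And>k. sum u {N k..<N (Suc k)} \<le> (1 + suminf u) * (1/4) ^ k"
proof -
  \<comment> \<open>All finite sums starting at \<open>x\<close> are bounded, not just the sum up to
    the next break point, so each break point can be chosen before its successor is known.\<close>
  let ?P = "\<lambda>k x. (k = 0 \<longrightarrow> x = 0) \<and> (\<forall>m. sum u {x..<m} \<le> (1 + suminf u) * (1/4) ^ k)"
  have pos: "0 \<le> suminf u" by (intro suminf_nonneg assms)
  have "\<exists>N. \<forall>k. ?P k (N k) \<and> N k < N (Suc k)"
  proof (rule dependent_nat_choice)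
    have "sum u {0..<m} \<le> 1 + suminf u" for m
      using sum_le_suminf[OF assms(1), of "{0..<m}"] nonneg by auto
    thus "\<exists>x. ?P 0 x" by (intro exI[of _ 0]) auto
    fix x k
    have "(1 + suminf u) * (1/4) ^ Suc k > 0" using pos by simp
    then obtain M where M: "\<And>m n. m \<ge> M \<Longrightarrow> norm (sum u {m..<n}) < (1 + suminf u) * (1/4) ^ Suc k"
      using assms(1) unfolding summable_Cauchy by blast
    show "\<exists>y. ?P (Suc k) y \<and> x < y"
    proof (intro exI conjI allI)
      fix m show "sum u {max M (Suc x)..<m} \<le> (1 + suminf u) * (1/4) ^ Suc k"
        using M[of "max M (Suc x)" m] by simp
    qed auto
  qed
  then obtain N where "\<And>k. ?P k (N k)" "\<And>k. N k < N (Suc k)" by blast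
  thus ?thesis using that[of N] by (auto simp: strict_mono_Suc_iff)
qed

text \<open>
  Riesz and Fischer's argument: \<open>v\<close> is the \<open>L\<^sup>1\<close> limit of a sufficiently sparse sequence of partial sums.
\<close>

lemma square_summable_boundary_function:
  fixes g :: "nat \<Rightarrow> complex"
  assumes g: "summable (\<lambda>n. (cmod (g n))\<^sup>2)"
  obtains N :: "nat \<Rightarrow> nat" and v :: "real \<Rightarrow> complex"
  where "strict_mono N" "v absolutely_integrable_on {0..2 * pi}"
    "\<forall>\<phi> C. \<phi> \<in> borel_measurable lebesgue \<longrightarrow> (\<forall>t. cmod (\<phi> t) \<le> C) \<longrightarrow>
      (\<lambda>t. \<phi> t * v t) absolutely_integrable_on {0..2 * pi} \<and>
      (\<lambda>k. integral {0..2 * pi} (\<lambda>t. \<phi> t * (\<Sum>n<N k. g n * cis t ^ n))) \<longlonglongrightarrow> integral {0..2 * pi} (\<lambda>t. \<phi> t * v t)"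
proof -
  define A where "A = 1 + (\<Sum>n. (cmod (g n))\<^sup>2)"
  obtain N where N: "N 0 = 0" "strict_mono N"
    "\<And>k. (\<Sum>n\<in>{N k..<N (Suc k)}. (cmod (g n))\<^sup>2) \<le> A * (1/4) ^ k"
    using summable_block_tails[OF g] unfolding A_def by auto
  define D where "D k t = (\<Sum>n\<in>{N k..<N (Suc k)}. g n * cis t ^ n)" for k t
  define f where "f k t = indicator {0..2 * pi} t *\<^sub>R D k t" for k and t :: real
  define v where "v t = (\<Sum>k. f k t)" for t
  have Dcont: "continuous_on S (D k)" for k S unfolding D_def by (intro continuous_intros)
  have Dint: "D k absolutely_integrable_on {0..2 * pi}" for k
    by (intro absolutely_integrable_continuous_real Dcont)
  have fint: "integrable lebesgue (f k)" for k
    using Dint[of k] unfolding set_integrable_def f_def .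
  have fnorm: "(LINT t|lebesgue. cmod (f k t)) \<le> pi * (1 + A) * (1/2) ^ k" for k
  proof -
    have "(LINT t|lebesgue. cmod (f k t)) = (LINT t:{0..2 * pi}|lebesgue. cmod (D k t))"
      unfolding set_lebesgue_integral_def f_def by (intro Bochner_Integration.integral_cong) auto
    also have "\<dots> = integral {0..2 * pi} (\<lambda>t. cmod (D k t))"
      by (intro set_lebesgue_integral_eq_integral absolutely_integrable_norm Dint[unfolded o_def])
         (use absolutely_integrable_norm[OF Dint] in \<open>simp add: o_def\<close>)
    also have "\<dots> \<le> (2 * pi * (1/2) ^ k + 2 ^ k * (2 * pi * (\<Sum>n\<in>{N k..<N (Suc k)}. (cmod (g n))\<^sup>2))) / 2"
    proof (rule has_integral_le)
      show "((\<lambda>t. cmod (D k t)) has_integral integral {0..2 * pi} (\<lambda>t. cmod (D k t))) {0..2 * pi}"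
        by (intro integrable_integral integrable_continuous_real continuous_intros Dcont)
      have "((\<lambda>t::real. (1/2::real) ^ k) has_integral 2 * pi * (1/2) ^ k) {0..2 * pi}"
        using has_integral_const_real[of "(1/2::real) ^ k" 0 "2 * pi"] by simp
      thus "((\<lambda>t. ((1/2) ^ k + 2 ^ k * (cmod (D k t))\<^sup>2) / 2) has_integral
         (2 * pi * (1/2) ^ k + 2 ^ k * (2 * pi * (\<Sum>n\<in>{N k..<N (Suc k)}. (cmod (g n))\<^sup>2))) / 2) {0..2 * pi}"
        unfolding D_def by (intro has_integral_divide has_integral_add has_integral_mult_right has_integral_parseval_finite) auto
      fix t
      \<comment> \<open>\<open>2 x \<le> s + x\<^sup>2 / s\<close> with \<open>s = 2\<^sup>-\<^sup>k\<close> replaces the Cauchy--Schwarz inequality for integrals\<close>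
      have "0 \<le> ((1/2) ^ k - cmod (D k t))\<^sup>2 * 2 ^ k" by simp
      also have "\<dots> = (1/2) ^ k - 2 * cmod (D k t) + 2 ^ k * (cmod (D k t))\<^sup>2"
        by (simp add: power2_diff algebra_simps power_one_over) (simp add: power2_eq_square field_simps)
      finally show "cmod (D k t) \<le> ((1/2) ^ k + 2 ^ k * (cmod (D k t))\<^sup>2) / 2" by simp
    qed
    also have "\<dots> \<le> (2 * pi * (1/2) ^ k + 2 ^ k * (2 * pi * (A * (1/4) ^ k))) / 2"
      using N(3)[of k] by (intro divide_right_mono add_left_mono mult_left_mono) auto
    also have "\<dots> = pi * (1 + A) * (1/2) ^ k"
    proof -
      have "(2::real) ^ k * (1/4) ^ k = (1/2) ^ k" by (simp flip: power_mult_distrib)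
      hence "2 ^ k * (2 * pi * (A * (1/4) ^ k)) = 2 * pi * A * (1/2) ^ k" by (simp add: mult_ac)
      thus ?thesis by (simp add: algebra_simps)
    qed
    finally show ?thesis .
  qed
  have geo: "summable (\<lambda>k. pi * (1 + A) * (1/2::real) ^ k)"
    by (intro summable_mult summable_geometric) simp
  have fsum: "summable (\<lambda>k. LINT t|lebesgue. cmod (f k t))"
    by (rule summable_comparison_test'[OF geo, of 0]) (use fnorm in simp)
  have AE: "AE t in lebesgue. summable (\<lambda>k. cmod (f k t))"
    by (rule integrable_suminf_AE_summable[OF fint fsum])
  have vint: "integrable lebesgue v"
    unfolding v_def by (rule integrable_suminf[OF fint AE fsum])
  \<comment> \<open>Every \<open>f k\<close> carries the indicator, so \<open>v\<close> vanishes off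
    the interval, and integrals over the line and over the interval can be exchanged.\<close>
  have vout: "indicator {0..2 * pi} t *\<^sub>R v t = v t" for t
    unfolding v_def f_def by (auto split: split_indicator)
  show ?thesis
  proof (rule that[OF N(2)])
    show "v absolutely_integrable_on {0..2 * pi}"
      unfolding set_integrable_def vout by (rule vint)
    \<comment> \<open>The multiplier stays arbitrary because two kinds are used later: a truncated
      exponential, to integrate over \<open>{0..x}\<close>, and conjugated monomials, to read off
      coefficients.\<close>
    show "\<forall>\<phi> C. \<phi> \<in> borel_measurable lebesgue \<longrightarrow> (\<forall>t. cmod (\<phi> t) \<le> C) \<longrightarrow>
      (\<lambda>t. \<phi> t * v t) absolutely_integrable_on {0..2 * pi} \<and>
      (\<lambda>k. integral {0..2 * pi} (\<lambda>t. \<phi> t * (\<Sum>n<N k. g n * cis t ^ n))) \<longlonglongrightarrow> integral {0..2 * pi} (\<lambda>t. \<phi> t * v t)"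
    proof (intro allI impI)
      fix \<phi> :: "real \<Rightarrow> complex" and C
      assume \<phi>[measurable]: "\<phi> \<in> borel_measurable lebesgue" and C': "\<forall>t. cmod (\<phi> t) \<le> C"
      have C: "cmod (\<phi> t) \<le> C" for t using C' by blast
      have C0: "0 \<le> C" using C[of 0] norm_ge_zero order_trans by blast
      have mult: "integrable lebesgue (\<lambda>t. \<phi> t * h t)" if "integrable lebesgue h" for h :: "real \<Rightarrow> complex"
      proof (rule Bochner_Integration.integrable_bound)
        show "integrable lebesgue (\<lambda>t. C * cmod (h t))" using that by simp
        show "(\<lambda>t. \<phi> t * h t) \<in> borel_measurable lebesgue" using that by simp
        show "AE t in lebesgue. norm (\<phi> t * h t) \<le> norm (C * cmod (h t))"
          using C C0 by (simp add: norm_mult abs_mult mult_right_mono)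
      qed
      have pint: "integrable lebesgue (\<lambda>t. \<phi> t * f k t)" for k by (rule mult[OF fint])
      have pAE: "AE t in lebesgue. summable (\<lambda>k. cmod (\<phi> t * f k t))"
        using AE by eventually_elim (simp add: norm_mult summable_mult)
      have psum: "summable (\<lambda>k. LINT t|lebesgue. cmod (\<phi> t * f k t))"
      proof (rule summable_comparison_test'[OF summable_mult[OF fsum, of C], of 0])
        fix k
        have "(LINT t|lebesgue. cmod (\<phi> t * f k t)) \<le> (LINT t|lebesgue. C * cmod (f k t))"
          using pint fint C by (intro integral_mono integrable_norm) (auto simp: norm_mult mult_right_mono)
        thus "norm (LINT t|lebesgue. cmod (\<phi> t * f k t)) \<le> C * (LINT t|lebesgue. cmod (f k t))" by simp
      qed
      have "(\<lambda>k. LINT t|lebesgue. \<phi> t * f k t) sums (LINT t|lebesgue. (\<Sum>k. \<phi> t * f k t))"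
        by (rule sums_integral[OF pint pAE psum])
      also have "(LINT t|lebesgue. (\<Sum>k. \<phi> t * f k t)) = (LINT t|lebesgue. \<phi> t * v t)"
      proof (rule integral_cong_AE)
        show "(\<lambda>t. \<Sum>k. \<phi> t * f k t) \<in> borel_measurable lebesgue"
          using integrable_suminf[OF pint pAE psum] by simp
        show "(\<lambda>t. \<phi> t * v t) \<in> borel_measurable lebesgue" using vint by simp
        show "AE t in lebesgue. (\<Sum>k. \<phi> t * f k t) = \<phi> t * v t"
          using AE by eventually_elim (simp add: v_def suminf_mult summable_norm_cancel)
      qed
      finally have lim: "(\<lambda>K. \<Sum>k<K. LINT t|lebesgue. \<phi> t * f k t) \<longlonglongrightarrow> (LINT t|lebesgue. \<phi> t * v t)"
        unfolding sums_def .
      have pv: "(\<lambda>t. \<phi> t * v t) absolutely_integrable_on {0..2 * pi}"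
      proof -
        have "indicator {0..2 * pi} t *\<^sub>R (\<phi> t * v t) = \<phi> t * v t" for t
          using vout[of t] by (metis mult_scaleR_right)
        thus ?thesis unfolding set_integrable_def using mult[OF vint] by simp
      qed
      have "(LINT t|lebesgue. \<phi> t * v t) = (LINT t:{0..2 * pi}|lebesgue. \<phi> t * v t)"
        unfolding set_lebesgue_integral_def using vout by (intro Bochner_Integration.integral_cong) (auto simp flip: mult_scaleR_right)
      also have "\<dots> = integral {0..2 * pi} (\<lambda>t. \<phi> t * v t)"
        by (rule set_lebesgue_integral_eq_integral(2)[OF pv])
      finally have 1: "(LINT t|lebesgue. \<phi> t * v t) = integral {0..2 * pi} (\<lambda>t. \<phi> t * v t)" .
      have 2: "(\<Sum>k<K. LINT t|lebesgue. \<phi> t * f k t) = integral {0..2 * pi} (\<lambda>t. \<phi> t * (\<Sum>n<N K. g n * cis t ^ n))" for K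
      proof -
        \<comment> \<open>The first block starts at \<open>N 0 = 0\<close>, so the blocks add up to
          full partial sums.\<close>
        have part: "(\<Sum>k<K. D k t) = (\<Sum>n<N K. g n * cis t ^ n)" for t
        proof (induction K)
          case (Suc K)
          have "N K \<le> N (Suc K)" using N(2) by (simp add: strict_mono_less_eq)
          hence "(\<Sum>n<N K. g n * cis t ^ n) + D K t = (\<Sum>n<N (Suc K). g n * cis t ^ n)"
            unfolding D_def lessThan_atLeast0 by (intro sum.atLeastLessThan_concat) auto
          thus ?case using Suc by simp
        qed (simp add: N(1))
        have "(\<Sum>k<K. LINT t|lebesgue. \<phi> t * f k t) = (LINT t|lebesgue. (\<Sum>k<K. \<phi> t * f k t))"
          using pint by simp
        also have "(\<lambda>t. \<Sum>k<K. \<phi> t * f k t) = (\<lambda>t. indicator {0..2 * pi} t *\<^sub>R (\<phi> t * (\<Sum>n<N K. g n * cis t ^ n)))"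
          unfolding part[symmetric] f_def by (simp add: sum_distrib_left scaleR_sum_right)
        finally have eq: "(\<Sum>k<K. LINT t|lebesgue. \<phi> t * f k t) = (LINT t:{0..2*pi}|lebesgue. \<phi> t * (\<Sum>n<N K. g n * cis t ^ n))"
          unfolding set_lebesgue_integral_def .
        have "integrable lebesgue (\<lambda>t. \<Sum>k<K. \<phi> t * f k t)" using pint by simp
        also have "(\<lambda>t. \<Sum>k<K. \<phi> t * f k t) = (\<lambda>t. indicator {0..2 * pi} t *\<^sub>R (\<phi> t * (\<Sum>n<N K. g n * cis t ^ n)))"
          unfolding part[symmetric] f_def by (simp add: sum_distrib_left scaleR_sum_right)
        finally show ?thesis unfolding eq
          by (intro set_lebesgue_integral_eq_integral(2)) (simp add: set_integrable_def)
      qed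
      show "(\<lambda>t. \<phi> t * v t) absolutely_integrable_on {0..2 * pi} \<and>
        (\<lambda>k. integral {0..2 * pi} (\<lambda>t. \<phi> t * (\<Sum>n<N k. g n * cis t ^ n))) \<longlonglongrightarrow> integral {0..2 * pi} (\<lambda>t. \<phi> t * v t)"
        using pv lim unfolding 1 2 by blast
    qed
  qed
qed

section \<open>Boundary values in the Hardy space\<close>

text \<open>\<open>integrable_ccontinuous_explicit\<close> controls averages over intervals to the
  right of a point. Applying it to the reflected function handles the left side, whose exceptional
  set is reflected back by \<open>uminus\<close>. Extension by zero provides integrability on every
  interval.\<close>

lemma lebesgue_differentiation_real:
  fixes f :: "real \<Rightarrow> 'b :: euclidean_space"
  assumes int: "f integrable_on {a..b}"
  obtains N where "negligible N"
    "\<And>x. x \<in> {a<..<b} - N \<Longrightarrow> ((\<lambda>y. integral {a..y} f) has_vector_derivative f x) (at x)"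
proof -
  define F where "F x = (if x \<in> {a..b} then f x else 0)" for x
  have "F integrable_on UNIV" unfolding F_def using int by (simp only: integrable_restrict_UNIV)
  hence Fint: "F integrable_on cbox c d" for c d by (rule integrable_on_subcbox) simp
  have Fint': "(\<lambda>x. F (- x)) integrable_on cbox c d" for c d
    using Fint[of "-d" "-c"] integrable_reflect[where f = F and a = "-d" and b = "-c"] by simp
  obtain N1 where N1: "negligible N1" "\<And>x e. x \<notin> N1 \<Longrightarrow> 0 < e \<Longrightarrow>
     \<exists>d>0. \<forall>h. 0 < h \<and> h < d \<longrightarrow> norm (integral (cbox x (x + h *\<^sub>R One)) F /\<^sub>R h ^ DIM(real) - F x) < e"
    using integrable_ccontinuous_explicit[OF Fint] by blast
  obtain N2 where N2: "negligible N2" "\<And>x e. x \<notin> N2 \<Longrightarrow> 0 < e \<Longrightarrow>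
     \<exists>d>0. \<forall>h. 0 < h \<and> h < d \<longrightarrow> norm (integral (cbox x (x + h *\<^sub>R One)) (\<lambda>x. F (- x)) /\<^sub>R h ^ DIM(real) - F (- x)) < e"
    using integrable_ccontinuous_explicit[OF Fint'] by blast
  have *: "norm (I - h *\<^sub>R y) \<le> e * h" if "norm (I /\<^sub>R h - y) < e" "0 < h" for I y :: 'b and h e :: real
  proof -
    have "I - h *\<^sub>R y = h *\<^sub>R (I /\<^sub>R h - y)" using that(2) by (simp add: algebra_simps)
    hence "norm (I - h *\<^sub>R y) = h * norm (I /\<^sub>R h - y)" using that(2) by simp
    also have "\<dots> \<le> h * e" using that by (intro mult_left_mono) auto
    finally show ?thesis by (simp add: mult.commute)
  qed
  show ?thesis
  proof (rule that[of "N1 \<union> uminus ` N2"])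
    show "negligible (N1 \<union> uminus ` N2)"
      using N1(1) N2(1) by (intro negligible_Un negligible_differentiable_image_negligible)
         (auto intro!: derivative_intros simp: differentiable_on_def)
    fix x assume x: "x \<in> {a<..<b} - (N1 \<union> uminus ` N2)"
    have xN: "x \<notin> N1" "- x \<notin> N2" using x by force+
    have Fx: "F x = f x" using x by (simp add: F_def)
    have comb: "integral {a..d} f - integral {a..c} f = integral {c..d} F" if "a \<le> c" "c \<le> d" "d \<le> b" for c d
    proof -
      have "integral {a..c} f + integral {c..d} f = integral {a..d} f"
        using that by (intro Henstock_Kurzweil_Integration.integral_combine integrable_on_subinterval[OF int]) auto
      moreover have "integral {c..d} f = integral {c..d} F"
        using that by (intro Henstock_Kurzweil_Integration.integral_cong) (auto simp: F_def)
      ultimately show ?thesis by (simp add: algebra_simps)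
    qed
    show "((\<lambda>y. integral {a..y} f) has_vector_derivative f x) (at x)"
      unfolding has_vector_derivative_def has_derivative_at_alt
    proof (intro conjI allI impI bounded_linear_scaleR_left)
      fix e :: real assume e: "0 < e"
      obtain d1 where d1: "d1 > 0" "\<And>h. 0 < h \<Longrightarrow> h < d1 \<Longrightarrow> norm (integral {x..x + h} F /\<^sub>R h - F x) < e"
        using N1(2)[OF xN(1) e] by auto
      obtain d2 where d2: "d2 > 0" "\<And>h. 0 < h \<Longrightarrow> h < d2 \<Longrightarrow> norm (integral {- x..- x + h} (\<lambda>x. F (- x)) /\<^sub>R h - F x) < e"
        using N2(2)[OF xN(2) e] by auto
      define d where "d = min (min d1 d2) (min (x - a) (b - x))"
      have "d > 0" using d1 d2 x by (simp add: d_def)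
      moreover have "norm (integral {a..y} f - integral {a..x} f - (y - x) *\<^sub>R f x) \<le> e * norm (y - x)"
        if y: "norm (y - x) < d" for y
      proof (cases "x < y")
        case True
        have "norm (integral {x..x + (y - x)} F - (y - x) *\<^sub>R F x) \<le> e * (y - x)"
          using True y by (intro * d1(2)) (auto simp: d_def)
        thus ?thesis using comb[of x y] True x y by (simp add: Fx d_def)
      next
        case False
        show ?thesis
        proof (cases "x = y")
          case False
          with \<open>\<not> x < y\<close> have yx: "y < x" by simp
          have "norm (integral {- x..- x + (x - y)} (\<lambda>x. F (- x)) - (x - y) *\<^sub>R F x) \<le> e * (x - y)"
            using yx y by (intro * d2(2)) (auto simp: d_def)
          also have "integral {- x..- x + (x - y)} (\<lambda>x. F (- x)) = integral {y..x} F"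
            using integral_reflect[where f = F and a = y and b = x] by simp
          also have "\<dots> = integral {a..x} f - integral {a..y} f"
            using comb[of y x] yx x y by (simp add: d_def)
          also have "norm (integral {a..x} f - integral {a..y} f - (x - y) *\<^sub>R F x) =
             norm (integral {a..y} f - integral {a..x} f - (y - x) *\<^sub>R f x)"
            unfolding Fx by (subst norm_minus_cancel[symmetric]) (simp add: algebra_simps)
          finally show ?thesis using yx by simp
        qed simp
      qed
      ultimately show "\<exists>d>0. \<forall>y. norm (y - x) < d \<longrightarrow>
          norm (integral {a..y} f - integral {a..x} f - (y - x) *\<^sub>R f x) \<le> e * norm (y - x)" by blast
    qed
  qed
qed

text \<open>Converts estimates in the angle into estimates in the chord. The derivative of
  \<open>Ln\<close> at 1 is 1, so near 1 the error of the linear approximation is at most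
  \<open>cmod (w - 1)\<close>, whence the factor 2.\<close>

lemma unit_circle_Ln_bound:
  obtains d where "d > 0" "\<And>w. cmod w = 1 \<Longrightarrow> cmod (w - 1) < d \<Longrightarrow> cis (Im (Ln w)) = w \<and> \<bar>Im (Ln w)\<bar> \<le> 2 * cmod (w - 1)"
proof -
  have "(Ln has_field_derivative inverse 1) (at 1)" by (rule has_field_derivative_Ln) simp
  hence "\<forall>e>0. \<exists>d>0. \<forall>y. norm (y - 1) < d \<longrightarrow> norm (Ln y - Ln 1 - inverse 1 * (y - 1)) \<le> e * norm (y - 1)"
    unfolding has_field_derivative_def has_derivative_at_alt by (rule conjunct2)
  from this[rule_format, of 1]
  obtain d where d: "d > 0" "\<And>y. norm (y - 1) < d \<Longrightarrow> norm (Ln y - (y - 1)) \<le> norm (y - 1)"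
    by auto
  show ?thesis
  proof (rule that[OF d(1)], intro conjI)
    fix w :: complex assume w: "cmod w = 1" "cmod (w - 1) < d"
    have w0: "w \<noteq> 0" using w by auto
    have "Ln w = \<i> * Im (Ln w)" using w w0 by (simp add: complex_eq_iff Re_Ln)
    thus "cis (Im (Ln w)) = w" using exp_Ln[OF w0] by (metis cis_conv_exp)
    have "\<bar>Im (Ln w)\<bar> \<le> cmod (Ln w)" by (rule abs_Im_le_cmod)
    also have "\<dots> \<le> cmod (Ln w - (w - 1)) + cmod (w - 1)" using norm_triangle_ineq[of "Ln w - (w - 1)" "w - 1"] by simp
    finally show "\<bar>Im (Ln w)\<bar> \<le> 2 * cmod (w - 1)" using d(2)[OF w(2)] by simp
  qed
qed

text \<open>Rotating the boundary point to 1 and subtracting the affine function with the same value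
  and the same tangential derivative reduces the claim to \<open>fatou_derivative_zero\<close>. The
  factor \<open>\<i> * cis t\<close> is the velocity of the circle, so \<open>c\<close> stands for
  the complex derivative.\<close>

lemma fatou_radial_derivative:
  fixes B :: "complex \<Rightarrow> complex"
  assumes cont: "continuous_on (cball 0 1) B" and hol: "B holomorphic_on ball 0 1"
    and der: "((\<lambda>s. B (cis s)) has_vector_derivative \<i> * cis t * c) (at t)"
  shows "((\<lambda>r::real. deriv B (of_real r * cis t)) \<longlongrightarrow> c) (at_left 1)"
proof -
  define R where "R w = B (cis t * w) - B (cis t) - c * cis t * (w - 1)" for w
  have lim: "((\<lambda>r::real. deriv R (of_real r)) \<longlongrightarrow> 0) (at_left 1)"
  proof (rule fatou_derivative_zero)
    show "continuous_on (cball 0 1) R" unfolding R_def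
      by (intro continuous_intros continuous_on_compose2[OF cont]) (auto simp: norm_mult)
    show "R holomorphic_on ball 0 1" unfolding R_def
      by (intro holomorphic_intros holomorphic_on_compose_gen[OF _ hol, unfolded o_def]) (auto simp: norm_mult)
    have "((\<lambda>s. B (cis (t + s))) has_vector_derivative 1 *\<^sub>R (\<i> * cis t * c)) (at 0)"
    proof (rule vector_diff_chain_at[of "\<lambda>s. t + s" 1 0 "\<lambda>s. B (cis s)" "\<i> * cis t * c", unfolded o_def])
      show "((\<lambda>s. t + s) has_vector_derivative 1) (at 0)"
        using has_vector_derivative_add[OF has_vector_derivative_const[of t] has_vector_derivative_id] by simp
    qed (use der in simp)
    moreover have "((\<lambda>s. c * cis t * (exp (\<i> * of_real s) - 1)) has_vector_derivative c * cis t * \<i>) (at 0)"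
      by (rule has_vector_derivative_real_field) (auto intro!: derivative_eq_intros)
    ultimately have "((\<lambda>s. B (cis (t + s)) - B (cis t) - c * cis t * (exp (\<i> * of_real s) - 1)) has_vector_derivative
        1 *\<^sub>R (\<i> * cis t * c) - 0 - c * cis t * \<i>) (at 0)"
      by (intro has_vector_derivative_diff has_vector_derivative_const)
    hence Rder: "((\<lambda>s. R (cis s)) has_vector_derivative 0) (at 0)"
      by (simp add: R_def cis_mult cis_conv_exp algebra_simps exp_add)
    fix \<epsilon> :: real assume eps: "\<epsilon> > 0"
    have R1: "R 1 = 0" by (simp add: R_def)
    \<comment> \<open>The halves in \<open>\<epsilon> / 2\<close> here and in \<open>d / 2\<close>
      below absorb the factor 2 between angle and chord.\<close>
    obtain d where d: "d > 0" "\<And>s. \<bar>s\<bar> < d \<Longrightarrow> cmod (R (cis s)) \<le> \<epsilon> / 2 * \<bar>s\<bar>"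
      using conjunct2[OF Rder[unfolded has_vector_derivative_def has_derivative_at_alt], rule_format, of "\<epsilon> / 2"] eps R1
      by auto
    obtain d' where d': "d' > 0" "\<And>w. cmod w = 1 \<Longrightarrow> cmod (w - 1) < d' \<Longrightarrow> cis (Im (Ln w)) = w \<and> \<bar>Im (Ln w)\<bar> \<le> 2 * cmod (w - 1)"
      using unit_circle_Ln_bound by blast
    show "\<exists>\<delta>>0. \<forall>w. cmod w = 1 \<longrightarrow> cmod (w - 1) < \<delta> \<longrightarrow> cmod (R w) \<le> \<epsilon> * cmod (w - 1)"
    proof (intro exI[of _ "min d' (d / 2)"] conjI allI impI)
      fix w assume w: "cmod w = 1" "cmod (w - 1) < min d' (d / 2)"
      have s: "cis (Im (Ln w)) = w" "\<bar>Im (Ln w)\<bar> \<le> 2 * cmod (w - 1)" using d'(2)[of w] w by auto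
      have "cmod (R w) \<le> \<epsilon> / 2 * \<bar>Im (Ln w)\<bar>"
        using d(2)[of "Im (Ln w)"] s w by simp
      also have "\<dots> \<le> \<epsilon> / 2 * (2 * cmod (w - 1))" using eps s by (intro mult_left_mono) auto
      finally show "cmod (R w) \<le> \<epsilon> * cmod (w - 1)" by simp
    qed (use d d' in auto)
  qed
  have "\<forall>\<^sub>F r in at_left (1::real). r \<in> {0<..<1}" by (rule eventually_at_left_real) simp
  hence "\<forall>\<^sub>F r in at_left (1::real). cnj (cis t) * deriv R (of_real r) + c = deriv B (of_real r * cis t)"
  proof eventually_elim
    case (elim r)
    have "(B has_field_derivative deriv B (cis t * r)) (at (cis t * of_real r))"
      using elim by (intro holomorphic_derivI[OF hol]) (auto simp: norm_mult)
    hence "(R has_field_derivative deriv B (cis t * r) * cis t - c * cis t) (at (of_real r))"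
      unfolding R_def by (auto intro!: derivative_eq_intros DERIV_chain2[where f = B])
    hence eq: "deriv R (of_real r) = deriv B (cis t * r) * cis t - c * cis t" by (rule DERIV_imp_deriv)
    have "cnj (cis t) * cis t = 1" by (simp add: cis_cnj cis_mult)
    thus ?case unfolding eq by (simp add: algebra_simps)
  qed
  moreover have "((\<lambda>r. cnj (cis t) * deriv R (of_real r) + c) \<longlongrightarrow> cnj (cis t) * 0 + c) (at_left (1::real))"
    by (intro tendsto_intros lim)
  ultimately have "((\<lambda>r. deriv B (of_real r * cis t)) \<longlongrightarrow> cnj (cis t) * 0 + c) (at_left (1::real))"
    by (rule Lim_transform_eventually[rotated])
  thus ?thesis by simp
qed

lemma continuous_on_suminf_dominated:
  fixes f :: "nat \<Rightarrow> 'a :: topological_space \<Rightarrow> 'b :: banach"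
  assumes "\<And>n. continuous_on A (f n)" "\<And>n x. x \<in> A \<Longrightarrow> norm (f n x) \<le> M n" "summable M"
  shows "continuous_on A (\<lambda>x. \<Sum>n. f n x)"
  by (rule uniform_limit_theorem[OF _ Weierstrass_m_test[of A f M]])
     (use assms in \<open>auto intro!: continuous_intros always_eventually\<close>)

lemma borel_measurable_lebesgue_continuous:
  fixes f :: "real \<Rightarrow> complex"
  assumes "continuous_on UNIV f"
  shows "f \<in> borel_measurable lebesgue"
  using continuous_imp_measurable_on_sets_lebesgue[OF assms] by (simp add: lebesgue_on_UNIV_eq)

lemma radial_boundary_eq:
  assumes "((\<lambda>r. f (of_real r * \<zeta>)) \<longlongrightarrow> l) (at_left (1::real))"
  shows "radial_boundary f \<zeta> = l"
  unfolding radial_boundary_def by (rule tendsto_Lim[OF _ assms]) simp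

text \<open>\<open>square_summable_boundary_function\<close> yields \<open>v\<close> only as a limit
  in mean, without any relation to \<open>G\<close> along radii. The increments of \<open>B\<close>
  along the circle are integrals of \<open>\<i> * cis s * v s\<close>; differentiating them
  identifies \<open>v\<close> with the radial limit off a null set, so that integrability and
  Fourier coefficients of \<open>radial_boundary G\<close> are those of \<open>v\<close>.\<close>

theorem hardy_2_boundary:
  fixes G :: "complex \<Rightarrow> complex"
  assumes "G \<in> hardy_2"
  obtains N where "negligible N"
    "\<And>t. t \<in> {0..2 * pi} - N \<Longrightarrow> ((\<lambda>r. G (of_real r * cis t)) \<longlongrightarrow> radial_boundary G (cis t)) (at_left (1::real))"
    "(\<lambda>t. radial_boundary G (cis t)) absolutely_integrable_on {0..2 * pi}"
    "\<And>n. integral {0..2 * pi} (\<lambda>t. radial_boundary G (cis t) * cnj (cis t ^ n)) = 2 * pi * ((deriv ^^ n) G 0 / fact n)"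
proof -
  define g :: "nat \<Rightarrow> complex" where "g n = (deriv ^^ n) G 0 / fact n" for n
  have hol: "G holomorphic_on unit_disk" using assms by (simp add: hardy_2_def disk_analytic_def)
  have Gsums: "(\<lambda>n. g n * z ^ n) sums G z" if "z \<in> unit_disk" for z :: complex
    unfolding g_def by (rule taylor_sums[OF hol that])
  have gsq: "summable (\<lambda>n. (cmod (g n))\<^sup>2)"
    unfolding g_def by (rule hardy_2_coeffs_summable[OF assms])
  obtain N v where N: "strict_mono N" and v: "v absolutely_integrable_on {0..2 * pi}"
    and weak: "\<forall>\<phi> C. \<phi> \<in> borel_measurable lebesgue \<longrightarrow> (\<forall>t. cmod (\<phi> t) \<le> C) \<longrightarrow>
      (\<lambda>t. \<phi> t * v t) absolutely_integrable_on {0..2 * pi} \<and>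
      (\<lambda>k. integral {0..2 * pi} (\<lambda>t. \<phi> t * (\<Sum>n<N k. g n * cis t ^ n))) \<longlonglongrightarrow> integral {0..2 * pi} (\<lambda>t. \<phi> t * v t)"
    by (rule square_summable_boundary_function[OF gsq]) blast
  define c where "c n = g (n - 1) / of_nat n" for n \<comment> \<open>\<open>c 0 = 0\<close>, as \<open>x / 0 = 0\<close>\<close>
  define B :: "complex \<Rightarrow> complex" where "B z = (\<Sum>n. c n * z ^ n)" for z
  \<comment> \<open>Square summability becomes absolute summability after one integration, by the
    arithmetic-geometric mean inequality against \<open>1 / (n + 1)\<close>. This is what makes
    \<open>B\<close> continuous up to the circle.\<close>
  have csum: "summable (\<lambda>n. cmod (c n))"
  proof (subst summable_Suc_iff[symmetric], rule summable_comparison_test'[of _ 0])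
    show "summable (\<lambda>n. (cmod (g n))\<^sup>2 + inverse (real (Suc n) ^ 2))"
      using inverse_power_summable[of 2, where 'a = real]
        summable_Suc_iff[of "\<lambda>n. inverse (real n ^ 2)"] by (intro summable_add gsq) auto
    fix n
    have "0 \<le> (cmod (g n) - inverse (real (Suc n)))\<^sup>2" by simp
    hence "2 * (cmod (g n) * inverse (real (Suc n))) \<le> (cmod (g n))\<^sup>2 + inverse (real (Suc n) ^ 2)"
      by (simp add: power2_diff power_inverse)
    moreover have "cmod (c (Suc n)) = cmod (g n) * inverse (real (Suc n))"
      unfolding c_def norm_divide norm_of_nat by (simp add: divide_inverse del: of_nat_Suc)
    moreover have "0 \<le> cmod (c (Suc n))" by simp
    ultimately have "cmod (c (Suc n)) \<le> (cmod (g n))\<^sup>2 + inverse (real (Suc n) ^ 2)" by linarith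
    thus "norm (cmod (c (Suc n))) \<le> (cmod (g n))\<^sup>2 + inverse (real (Suc n) ^ 2)" by (simp del: of_nat_Suc)
  qed
  have cle: "cmod (c n * z ^ n) \<le> cmod (c n)" if "cmod z \<le> 1" for n z
    using that by (simp add: norm_mult norm_power mult_left_le power_le_one)
  have Bcont: "continuous_on (cball 0 1) B"
    unfolding B_def by (rule continuous_on_suminf_dominated[OF _ _ csum])
                       (use cle in \<open>auto intro!: continuous_intros\<close>)
  have Bsums: "(\<lambda>n. c n * z ^ n) sums B z" if "cmod z \<le> 1" for z
    unfolding B_def using that cle csum
    by (intro summable_sums summable_comparison_test'[OF csum, of 0]) auto
  have Bder: "(B has_field_derivative G z) (at z)" if "z \<in> unit_disk" for z
  proof -
    have "DERIV (\<lambda>z. \<Sum>n. c n * z ^ n) z :> (\<Sum>n. diffs c n * z ^ n)"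
      by (rule termdiffs_strong[of _ 1]) (use that csum in \<open>auto intro: summable_norm_cancel\<close>)
    moreover have "diffs c n = g n" for n by (simp add: diffs_def c_def del: of_nat_Suc)
    ultimately show ?thesis using Gsums[OF that] by (simp add: B_def[abs_def] sums_iff)
  qed
  have Bhol: "B holomorphic_on ball 0 1"
    by (metis Bder field_differentiable_def holomorphic_onI has_field_derivative_at_within)
  have Bint: "integral {0..x} (\<lambda>s. \<i> * cis s * v s) = B (cis x) - B 1" if x: "x \<in> {0..2 * pi}" for x
  proof -
    define \<phi> where "\<phi> s = (if s \<in> {0..x} then \<i> * cis s else 0)" for s
    have restrict: "integral {0..2 * pi} (\<lambda>s. \<phi> s * h s) = integral {0..x} (\<lambda>s. \<i> * cis s * h s)" for h
    proof -
      have "integral {0..2 * pi} (\<lambda>s. \<phi> s * h s) = integral {0..2 * pi} (\<lambda>s. if s \<in> {0..x} then \<i> * cis s * h s else 0)"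
        by (rule Henstock_Kurzweil_Integration.integral_cong) (simp add: \<phi>_def)
      also have "\<dots> = integral {0..x} (\<lambda>s. \<i> * cis s * h s)"
        using x unfolding integral_restrict_Int by (simp add: Int_absorb2 Int_absorb1)
      finally show ?thesis .
    qed
    have "\<phi> \<in> borel_measurable lebesgue"
    proof -
      have "(\<lambda>s. \<i> * cis s) \<in> borel_measurable lebesgue"
        by (intro borel_measurable_lebesgue_continuous continuous_intros)
      thus ?thesis unfolding \<phi>_def by (intro measurable_If) auto
    qed
    moreover have "cmod (\<phi> t) \<le> 1" for t by (simp add: \<phi>_def norm_mult)
    ultimately have "(\<lambda>k. integral {0..2 * pi} (\<lambda>t. \<phi> t * (\<Sum>n<N k. g n * cis t ^ n))) \<longlonglongrightarrow> integral {0..2 * pi} (\<lambda>t. \<phi> t * v t)"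
      using weak by blast
    \<comment> \<open>Multiplying by \<open>\<i> * cis s\<close> and integrating turns the term of
      \<open>g\<close> of degree \<open>n\<close> into the term of \<open>c\<close> of degree
      \<open>Suc n\<close>, hence the shift from \<open>M\<close> to \<open>Suc M\<close>.\<close>
    moreover have "integral {0..2 * pi} (\<lambda>t. \<phi> t * (\<Sum>n<M. g n * cis t ^ n)) = (\<Sum>n<Suc M. c n * (cis x) ^ n) - (\<Sum>n<Suc M. c n * 1 ^ n)" for M
    proof -
      have "((\<lambda>s. \<i> * cis s * (\<Sum>n<M. g n * cis s ^ n)) has_integral
         (\<Sum>n<Suc M. c n * exp (\<i> * x) ^ n) - (\<Sum>n<Suc M. c n * exp (\<i> * (0::real)) ^ n)) {0..x}"
      proof (rule fundamental_theorem_of_calculus)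
        fix s
        have "((\<lambda>z. \<Sum>n<Suc M. c n * exp (\<i> * z) ^ n) has_field_derivative
           (\<Sum>n<Suc M. c n * (of_nat n * exp (\<i> * s) ^ (n - 1) * (exp (\<i> * s) * \<i>)))) (at (of_real s))"
          by (auto intro!: derivative_eq_intros sum.cong simp del: sum.lessThan_Suc)
        also have "(\<Sum>n<Suc M. c n * (of_nat n * exp (\<i> * s) ^ (n - 1) * (exp (\<i> * s) * \<i>))) =
           (\<i> * cis s * (\<Sum>n<M. g n * cis s ^ n))"
          unfolding sum.lessThan_Suc_shift sum_distrib_left
          by (simp add: c_def cis_conv_exp mult_ac del: of_nat_Suc)
        finally show "((\<lambda>s. \<Sum>n<Suc M. c n * exp (\<i> * of_real s) ^ n) has_vector_derivative
           (\<i> * cis s * (\<Sum>n<M. g n * cis s ^ n))) (at s within {0..x})"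
          by (rule has_vector_derivative_real_field)
      qed (use x in auto)
      thus ?thesis unfolding restrict by (simp add: integral_unique cis_conv_exp del: sum.lessThan_Suc)
    qed
    moreover have "(\<lambda>k. (\<Sum>n<Suc (N k). c n * (cis x) ^ n) - (\<Sum>n<Suc (N k). c n * 1 ^ n)) \<longlonglongrightarrow> B (cis x) - B 1"
    proof (intro tendsto_diff)
      have sub: "filterlim (\<lambda>k. Suc (N k)) sequentially sequentially"
        by (rule filterlim_compose[OF filterlim_Suc filterlim_subseq[OF N]])
      show "(\<lambda>k. \<Sum>n<Suc (N k). c n * (cis x) ^ n) \<longlonglongrightarrow> B (cis x)"
        by (rule filterlim_compose[OF Bsums[unfolded sums_def] sub]) simp
      show "(\<lambda>k. \<Sum>n<Suc (N k). c n * 1 ^ n) \<longlonglongrightarrow> B 1"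
        by (rule filterlim_compose[OF Bsums[unfolded sums_def] sub]) simp
    qed
    ultimately have "integral {0..2 * pi} (\<lambda>t. \<phi> t * v t) = B (cis x) - B 1"
      using LIMSEQ_unique by simp
    thus ?thesis unfolding restrict .
  qed
  have "(\<lambda>s. \<i> * cis s) \<in> borel_measurable lebesgue"
    by (intro borel_measurable_lebesgue_continuous continuous_intros)
  hence "(\<lambda>s. \<i> * cis s * v s) absolutely_integrable_on {0..2 * pi}"
    using weak[rule_format, of "\<lambda>s. \<i> * cis s" 1] by (simp add: norm_mult)
  hence "(\<lambda>s. \<i> * cis s * v s) integrable_on {0..2 * pi}" by (rule set_lebesgue_integral_eq_integral(1))
  from lebesgue_differentiation_real[OF this] obtain Z where Z: "negligible Z"
    "\<And>x. x \<in> {0<..<2 * pi} - Z \<Longrightarrow> ((\<lambda>y. integral {0..y} (\<lambda>s. \<i> * cis s * v s)) has_vector_derivative \<i> * cis x * v x) (at x)"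
    by blast
  have lim: "((\<lambda>r. G (of_real r * cis t)) \<longlongrightarrow> v t) (at_left (1::real))" if t: "t \<in> {0<..<2 * pi} - Z" for t
  proof -
    have "((\<lambda>y. B 1 + integral {0..y} (\<lambda>s. \<i> * cis s * v s)) has_vector_derivative 0 + \<i> * cis t * v t) (at t)"
      by (intro has_vector_derivative_add has_vector_derivative_const Z t)
    hence "((\<lambda>s. B (cis s)) has_vector_derivative 0 + \<i> * cis t * v t) (at t)"
      by (rule has_vector_derivative_transform_within_open[of _ _ _ "{0<..<2 * pi}"]) (use t Bint in auto)
    hence "((\<lambda>r::real. deriv B (of_real r * cis t)) \<longlongrightarrow> v t) (at_left 1)"
      by (intro fatou_radial_derivative Bcont Bhol) simp
    moreover have "\<forall>\<^sub>F r in at_left (1::real). r \<in> {0<..<1}" by (rule eventually_at_left_real) simp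
    hence "\<forall>\<^sub>F r in at_left (1::real). deriv B (of_real r * cis t) = G (of_real r * cis t)"
      by eventually_elim (auto intro!: DERIV_imp_deriv Bder simp: norm_mult)
    ultimately show ?thesis by (simp cong: tendsto_cong)
  qed
  hence rb: "radial_boundary G (cis t) = v t" if "t \<in> {0<..<2 * pi} - Z" for t
    using that radial_boundary_eq by blast
  \<comment> \<open>Two-sided differentiation says nothing at the endpoints of the interval, so they
    join the exceptional set.\<close>
  define Z' where "Z' = insert 0 (insert (2 * pi) Z)"
  have Z': "negligible Z'" using Z(1) by (simp add: Z'_def)
  have sub: "t \<in> {0<..<2 * pi} - Z" if "t \<in> {0..2 * pi} - Z'" for t using that by (auto simp: Z'_def)
  show ?thesis
  proof (rule that[OF Z'])
    show "((\<lambda>r. G (of_real r * cis t)) \<longlongrightarrow> radial_boundary G (cis t)) (at_left (1::real))" if "t \<in> {0..2 * pi} - Z'" for t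
      using lim[OF sub[OF that]] rb[OF sub[OF that]] by simp
    show "(\<lambda>t. radial_boundary G (cis t)) absolutely_integrable_on {0..2 * pi}"
      by (rule absolutely_integrable_spike[OF v Z']) (use rb sub in blast)
    fix n
    have meas: "(\<lambda>t. cnj (cis t ^ n)) \<in> borel_measurable lebesgue"
      by (intro borel_measurable_lebesgue_continuous continuous_intros)
    have "integral {0..2 * pi} (\<lambda>t. radial_boundary G (cis t) * cnj (cis t ^ n)) = integral {0..2 * pi} (\<lambda>t. cnj (cis t ^ n) * v t)"
      by (rule integral_spike[OF Z']) (use rb sub in auto)
    also have "\<dots> = 2 * pi * g n"
    proof (rule LIMSEQ_unique)
      show "(\<lambda>k. integral {0..2 * pi} (\<lambda>t. cnj (cis t ^ n) * (\<Sum>n<N k. g n * cis t ^ n))) \<longlonglongrightarrow> integral {0..2 * pi} (\<lambda>t. cnj (cis t ^ n) * v t)"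
        using weak[rule_format, OF meas, of 1] by (simp add: norm_power)
      \<comment> \<open>Once \<open>N k\<close> exceeds \<open>n\<close>, orthogonality makes the
        pairing exact: the sequence is eventually constant.\<close>
      have "integral {0..2 * pi} (\<lambda>t. cnj (cis t ^ n) * (\<Sum>n<N k. g n * cis t ^ n)) = 2 * pi * g n" if "k > n" for k
      proof -
        have "n < N k" using that seq_suble[OF N, of k] by linarith
        have "((\<lambda>t. \<Sum>m<N k. g m * (cis t ^ m * cnj (cis t ^ n))) has_integral
            (\<Sum>m<N k. g m * (if m = n then of_real (2 * pi) else 0))) {0..2 * pi}"
          by (intro has_integral_sum has_integral_mult_right has_integral_circle_monomials) simp
        moreover have "(\<lambda>t. \<Sum>m<N k. g m * (cis t ^ m * cnj (cis t ^ n))) = (\<lambda>t. cnj (cis t ^ n) * (\<Sum>n<N k. g n * cis t ^ n))"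
          by (simp add: sum_distrib_left mult_ac)
        moreover have "(\<Sum>m<N k. g m * (if m = n then of_real (2 * pi) else 0)) = 2 * pi * g n"
          using \<open>n < N k\<close> by (simp add: if_distrib sum.delta cong: if_cong)
        ultimately show ?thesis by (simp add: integral_unique)
      qed
      hence "\<forall>\<^sub>F k in sequentially. integral {0..2 * pi} (\<lambda>t. cnj (cis t ^ n) * (\<Sum>n<N k. g n * cis t ^ n)) = 2 * pi * g n"
        by (auto simp: eventually_sequentially intro!: exI[of _ "Suc n"])
      thus "(\<lambda>k. integral {0..2 * pi} (\<lambda>t. cnj (cis t ^ n) * (\<Sum>n<N k. g n * cis t ^ n))) \<longlonglongrightarrow> 2 * pi * g n"
        by (rule tendsto_eventually)
    qed
    finally show "integral {0..2 * pi} (\<lambda>t. radial_boundary G (cis t) * cnj (cis t ^ n)) = 2 * pi * ((deriv ^^ n) G 0 / fact n)"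
      unfolding g_def .
  qed
qed

section \<open>The Riesz projection\<close>

text \<open>Members of the Hardy spaces are zero off the disk, so a function given by a formula on a
  larger region belongs to them only after this truncation.\<close>

definition disk_restrict :: "(complex \<Rightarrow> complex) \<Rightarrow> complex \<Rightarrow> complex"
  where "disk_restrict f z = (if z \<in> unit_disk then f z else 0)"

lemma disk_restrict_analytic:
  assumes "f holomorphic_on unit_disk"
  shows "disk_restrict f \<in> disk_analytic"
proof -
  have "disk_restrict f holomorphic_on unit_disk"
    using assms by (rule holomorphic_transform) (simp add: disk_restrict_def)
  thus ?thesis by (simp add: disk_analytic_def disk_restrict_def)
qed

lemma disk_restrict_hardy_inf:
  assumes "continuous_on (cball 0 1) f" "f holomorphic_on unit_disk"
  shows "disk_restrict f \<in> hardy_inf"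
proof -
  have "bounded (f ` cball 0 1)"
    by (intro compact_imp_bounded compact_continuous_image assms compact_cball)
  hence "bounded (disk_restrict f ` unit_disk)"
    by (rule bounded_subset) (auto simp: disk_restrict_def)
  thus ?thesis using disk_restrict_analytic[OF assms(2)] by (simp add: hardy_inf_def)
qed

lemma radial_boundary_disk_restrict:
  assumes "continuous_on (cball 0 1) f" "cmod \<zeta> = 1"
  shows "radial_boundary (disk_restrict f) \<zeta> = f \<zeta>"
proof (rule radial_boundary_eq)
  have ev: "\<forall>\<^sub>F r in at_left (1::real). r \<in> {0<..<1}" by (rule eventually_at_left_real) simp
  have "((\<lambda>r. f (of_real r * \<zeta>)) \<longlongrightarrow> f (of_real 1 * \<zeta>)) (at_left (1::real))"
  proof (rule continuous_on_tendsto_compose[OF assms(1)])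
    show "\<forall>\<^sub>F r in at_left (1::real). of_real r * \<zeta> \<in> cball 0 1"
      using ev by eventually_elim (use assms in \<open>simp add: norm_mult\<close>)
    show "((\<lambda>r. of_real r * \<zeta>) \<longlongrightarrow> of_real 1 * \<zeta>) (at_left (1::real))" by (intro tendsto_intros)
  qed (use assms in simp)
  hence "((\<lambda>r. f (of_real r * \<zeta>)) \<longlongrightarrow> f \<zeta>) (at_left (1::real))" by simp
  moreover have "\<forall>\<^sub>F r in at_left (1::real). f (of_real r * \<zeta>) = disk_restrict f (of_real r * \<zeta>)"
    using ev by eventually_elim (use assms in \<open>simp add: norm_mult disk_restrict_def\<close>)
  ultimately show "((\<lambda>r. disk_restrict f (of_real r * \<zeta>)) \<longlongrightarrow> f \<zeta>) (at_left (1::real))"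
    by (rule Lim_transform_eventually)
qed

lemma hardy_2_mult:
  assumes a: "a \<in> hardy_inf" and k: "k \<in> hardy_2"
  shows "(\<lambda>z. a z * k z) \<in> hardy_2"
proof -
  have hol: "a holomorphic_on unit_disk" "k holomorphic_on unit_disk"
    using assms by (simp_all add: hardy_inf_def hardy_2_def disk_analytic_def)
  have an: "(\<lambda>z. a z * k z) \<in> disk_analytic"
    using assms by (auto simp: hardy_inf_def hardy_2_def disk_analytic_def intro!: holomorphic_intros)
  obtain M where M: "\<And>z. z \<in> unit_disk \<Longrightarrow> cmod (a z) \<le> M"
    using a unfolding hardy_inf_def bounded_iff by blast
  obtain C where C: "\<forall>r\<in>{0<..<1}. (LINT t:{0..2*pi}|lebesgue. (cmod (k (of_real r * cis t)))\<^sup>2) / (2*pi) \<le> C"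
    using k unfolding hardy_2_def bdd_above_def mem_Collect_eq ball_simps by (elim conjE exE)
  have "(LINT t:{0..2*pi}|lebesgue. (cmod (a (of_real r * cis t) * k (of_real r * cis t)))\<^sup>2) / (2*pi) \<le> M\<^sup>2 * C"
    if r: "r \<in> {0<..<1}" for r
  proof -
    have ki: "(\<lambda>t. (cmod (k (of_real r * cis t)))\<^sup>2) absolutely_integrable_on {0..2 * pi}"
      using r hol by (intro circle_mean_integrable) auto
    have "(LINT t:{0..2*pi}|lebesgue. (cmod (a (of_real r * cis t) * k (of_real r * cis t)))\<^sup>2)
       \<le> (LINT t:{0..2*pi}|lebesgue. M\<^sup>2 * (cmod (k (of_real r * cis t)))\<^sup>2)"
    proof (rule set_integral_mono)
      show "(\<lambda>t. (cmod (a (of_real r * cis t) * k (of_real r * cis t)))\<^sup>2) absolutely_integrable_on {0..2 * pi}"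
        using r hol by (intro circle_mean_integrable holomorphic_intros) auto
      show "(\<lambda>t. M\<^sup>2 * (cmod (k (of_real r * cis t)))\<^sup>2) absolutely_integrable_on {0..2 * pi}"
        using ki by (rule set_integrable_mult_right)
      fix t
      have "cmod (a (of_real r * cis t)) \<le> M" using r by (intro M) (simp add: norm_mult)
      hence "(cmod (a (of_real r * cis t)))\<^sup>2 \<le> M\<^sup>2" by (intro power_mono) auto
      thus "(cmod (a (of_real r * cis t) * k (of_real r * cis t)))\<^sup>2 \<le> M\<^sup>2 * (cmod (k (of_real r * cis t)))\<^sup>2"
        by (simp add: norm_mult power_mult_distrib mult_right_mono)
    qed
    also have "\<dots> = M\<^sup>2 * (LINT t:{0..2*pi}|lebesgue. (cmod (k (of_real r * cis t)))\<^sup>2)" by simp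
    finally have "(LINT t:{0..2*pi}|lebesgue. (cmod (a (of_real r * cis t) * k (of_real r * cis t)))\<^sup>2) / (2 * pi)
       \<le> M\<^sup>2 * (LINT t:{0..2*pi}|lebesgue. (cmod (k (of_real r * cis t)))\<^sup>2) / (2 * pi)"
      by (intro divide_right_mono) auto
    also have "\<dots> \<le> M\<^sup>2 * C" using mult_left_mono[OF C[rule_format, OF r], of "M\<^sup>2"] by simp
    finally show ?thesis .
  qed
  thus ?thesis using an unfolding hardy_2_def by (auto intro!: bdd_aboveI[of _ "M\<^sup>2 * C"])
qed

text \<open>A bounded function is its own product with the constant 1 on the disk, so
  \<open>hardy_2_mult\<close> reduces the claim to that constant.\<close>

lemma hardy_inf_subset_hardy_2: "hardy_inf \<subseteq> hardy_2"
proof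
  fix f assume f: "f \<in> hardy_inf"
  have "(LINT t:{0..2*pi}|lebesgue. (cmod (disk_restrict (\<lambda>_. 1) (of_real r * cis t)))\<^sup>2) / (2*pi) = 1"
    if "r \<in> {0<..<1}" for r
  proof -
    have "of_real r * cis t \<in> unit_disk" for t using that by (simp add: norm_mult)
    hence "(LINT t:{0..2*pi}|lebesgue. (cmod (disk_restrict (\<lambda>_. 1) (of_real r * cis t)))\<^sup>2)
       = (LINT t:{0..2*pi}|lebesgue. (1::real))"
      unfolding disk_restrict_def by simp
    also have "\<dots> = 2 * pi"
    proof -
      have "(\<lambda>t::real. 1::real) absolutely_integrable_on {0..2 * pi}"
        by (intro absolutely_integrable_continuous_real continuous_intros)
      thus ?thesis by (simp add: set_lebesgue_integral_eq_integral)
    qed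
    finally show ?thesis by simp
  qed
  hence "disk_restrict (\<lambda>_. 1) \<in> hardy_2"
    using disk_restrict_analytic[of "\<lambda>_. 1"] unfolding hardy_2_def
    by (auto intro!: bdd_aboveI[of _ 1] simp: holomorphic_on_const)
  hence "(\<lambda>z. f z * disk_restrict (\<lambda>_. 1) z) \<in> hardy_2" by (rule hardy_2_mult[OF f])
  also have "(\<lambda>z. f z * disk_restrict (\<lambda>_. 1) z) = f"
    using f by (auto simp: hardy_inf_def disk_analytic_def disk_restrict_def)
  finally show "f \<in> hardy_2" .
qed

section \<open>Termwise integration and Cauchy's formula for boundary values\<close>

lemma absolutely_integrable_mult_continuous:
  fixes v \<phi> :: "real \<Rightarrow> complex"
  assumes "v absolutely_integrable_on {a..b}" "continuous_on {a..b} \<phi>"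
  shows "(\<lambda>t. v t * \<phi> t) absolutely_integrable_on {a..b}"
proof -
  have "(\<lambda>t. \<phi> t * v t) absolutely_integrable_on {a..b}"
  proof (rule absolutely_integrable_bounded_measurable_product[OF bilinear_times])
    show "\<phi> \<in> borel_measurable (lebesgue_on {a..b})"
      using assms(2) by (rule continuous_imp_measurable_on_sets_lebesgue) simp
    show "bounded (\<phi> ` {a..b})"
      using assms(2) by (intro compact_imp_bounded compact_continuous_image compact_Icc)
  qed (use assms in auto)
  thus ?thesis by (simp add: mult.commute)
qed

text \<open>Dominated convergence with majorant \<open>cmod (v t) * suminf M\<close>. It serves both
  the geometric expansion of one kernel and the series of many kernels.\<close>

lemma integral_mult_suminf_sums:
  fixes v :: "real \<Rightarrow> complex" and \<phi> :: "nat \<Rightarrow> real \<Rightarrow> complex"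
  assumes v: "v absolutely_integrable_on {a..b}" and cont: "\<And>n. continuous_on {a..b} (\<phi> n)"
    and M: "\<And>n t. t \<in> {a..b} \<Longrightarrow> cmod (\<phi> n t) \<le> M n" "summable M"
  shows "(\<lambda>n. integral {a..b} (\<lambda>t. v t * \<phi> n t)) sums integral {a..b} (\<lambda>t. v t * (\<Sum>n. \<phi> n t))"
proof -
  have int: "(\<lambda>t. v t * \<phi> n t) integrable_on {a..b}" for n
    by (intro set_lebesgue_integral_eq_integral(1) absolutely_integrable_mult_continuous v cont)
  have "(\<lambda>k. integral {a..b} (\<lambda>t. v t * (\<Sum>n<k. \<phi> n t))) \<longlonglongrightarrow> integral {a..b} (\<lambda>t. v t * (\<Sum>n. \<phi> n t))"
  proof (rule dominated_convergence(2))
    show "(\<lambda>t. v t * (\<Sum>n<k. \<phi> n t)) integrable_on {a..b}" for k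
      by (intro set_lebesgue_integral_eq_integral(1) absolutely_integrable_mult_continuous v cont continuous_intros)
    show "(\<lambda>t. cmod (v t) * suminf M) integrable_on {a..b}"
      using v by (intro integrable_on_mult_left) (simp add: absolutely_integrable_on_def)
    fix t assume t: "t \<in> {a..b}"
    have M0: "0 \<le> M n" for n using M(1)[OF t, of n] norm_ge_zero order_trans by blast
    show "norm (v t * (\<Sum>n<k. \<phi> n t)) \<le> cmod (v t) * suminf M" for k
    proof -
      have "cmod (\<Sum>n<k. \<phi> n t) \<le> (\<Sum>n<k. M n)" by (intro sum_norm_le M t)
      also have "\<dots> \<le> suminf M" using M0 by (intro sum_le_suminf M) auto
      finally show ?thesis by (simp add: norm_mult mult_left_mono)
    qed
    have "summable (\<lambda>n. \<phi> n t)" by (rule summable_comparison_test'[OF M(2), of 0]) (use M t in auto)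
    thus "(\<lambda>k. v t * (\<Sum>n<k. \<phi> n t)) \<longlonglongrightarrow> v t * (\<Sum>n. \<phi> n t)"
      by (intro tendsto_mult tendsto_const summable_LIMSEQ)
  qed
  also have "(\<lambda>k. integral {a..b} (\<lambda>t. v t * (\<Sum>n<k. \<phi> n t))) = (\<lambda>k. \<Sum>n<k. integral {a..b} (\<lambda>t. v t * \<phi> n t))"
    by (simp add: sum_distrib_left Henstock_Kurzweil_Integration.integral_sum[OF _ int])
  finally show ?thesis unfolding sums_def .
qed

lemma szego_denominator_lower:
  assumes "cmod l < 1" "cmod z \<le> 1"
  shows "1 - cmod l \<le> cmod (1 - cnj l * z)"
proof -
  have "cmod (cnj l * z) \<le> cmod l" using assms by (simp add: norm_mult mult_left_le)
  thus ?thesis using norm_triangle_ineq2[of 1 "cnj l * z"] by simp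
qed

text \<open>This is the reproducing property of the kernel. Each term of its geometric expansion
  picks out a Fourier coefficient of the boundary function, which is a Taylor coefficient of
  \<open>G\<close>, and the Taylor series reassembles at \<open>l\<close>.\<close>

lemma hardy_2_cauchy_formula:
  fixes G :: "complex \<Rightarrow> complex"
  assumes G: "G \<in> hardy_2" and l: "cmod l < 1"
  shows "integral {0..2 * pi} (\<lambda>t. radial_boundary G (cis t) * cnj (1 / (1 - cnj l * cis t))) = 2 * pi * G l"
proof -
  obtain N where int: "(\<lambda>t. radial_boundary G (cis t)) absolutely_integrable_on {0..2 * pi}"
    and coeff: "\<And>n. integral {0..2 * pi} (\<lambda>t. radial_boundary G (cis t) * cnj (cis t ^ n)) = 2 * pi * ((deriv ^^ n) G 0 / fact n)"
    by (rule hardy_2_boundary[OF G]) blast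
  have hol: "G holomorphic_on unit_disk" using G by (simp add: hardy_2_def disk_analytic_def)
  have geo: "(\<Sum>n. l ^ n * cnj (cis t ^ n)) = cnj (1 / (1 - cnj l * cis t))" for t
  proof -
    have "(\<lambda>n. (l * cnj (cis t)) ^ n) sums (1 / (1 - l * cnj (cis t)))"
      using l by (intro geometric_sums) (simp add: norm_mult)
    thus ?thesis by (simp add: sums_iff power_mult_distrib)
  qed
  have "(\<lambda>n. integral {0..2 * pi} (\<lambda>t. radial_boundary G (cis t) * (l ^ n * cnj (cis t ^ n)))) sums
      integral {0..2 * pi} (\<lambda>t. radial_boundary G (cis t) * (\<Sum>n. l ^ n * cnj (cis t ^ n)))"
    by (rule integral_mult_suminf_sums[OF int, where M = "\<lambda>n. cmod l ^ n"])
       (use l in \<open>auto intro!: continuous_intros summable_geometric simp: norm_mult norm_power\<close>)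
  moreover have "integral {0..2 * pi} (\<lambda>t. radial_boundary G (cis t) * (l ^ n * cnj (cis t ^ n)))
      = 2 * pi * ((deriv ^^ n) G 0 / fact n * l ^ n)" for n
  proof -
    have "integral {0..2 * pi} (\<lambda>t. radial_boundary G (cis t) * (l ^ n * cnj (cis t ^ n)))
      = integral {0..2 * pi} (\<lambda>t. l ^ n * (radial_boundary G (cis t) * cnj (cis t ^ n)))"
      by (simp add: mult_ac)
    also have "\<dots> = l ^ n * (2 * pi * ((deriv ^^ n) G 0 / fact n))"
      unfolding coeff[symmetric] by (rule integral_mult_right)
    finally show ?thesis by simp
  qed
  moreover have "(\<lambda>n. 2 * pi * ((deriv ^^ n) G 0 / fact n * l ^ n)) sums (2 * pi * G l)"
    using l by (intro sums_mult taylor_sums hol) simp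
  ultimately show ?thesis unfolding geo using sums_unique2 by simp
qed

text \<open>The description needs uniqueness: testing with the monomials determines all Taylor
  coefficients of a candidate, hence the candidate on the disk, and off the disk candidates are
  zero. Integrability of \<open>A\<close> allows the integral of the difference to be split.\<close>

lemma riesz_projection_eqI:
  assumes A: "(\<lambda>t. A (cis t)) absolutely_integrable_on {0..2 * pi}" and h: "h \<in> hardy_2"
    and orth: "\<And>k. k \<in> hardy_2 \<Longrightarrow> circle_inner (\<lambda>\<zeta>. A \<zeta> - radial_boundary h \<zeta>) (radial_boundary k) = 0"
  shows "riesz_projection A = h"
  unfolding riesz_projection_def
proof (rule the_equality)
  have coeff: "2 * pi * ((deriv ^^ n) x 0 / fact n) = integral {0..2 * pi} (\<lambda>t. A (cis t) * cnj (cis t ^ n))"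
    if x: "x \<in> hardy_2" and orth: "\<And>k. k \<in> hardy_2 \<Longrightarrow> circle_inner (\<lambda>\<zeta>. A \<zeta> - radial_boundary x \<zeta>) (radial_boundary k) = 0"
    for x :: "complex \<Rightarrow> complex" and n
  proof -
    obtain N where int: "(\<lambda>t. radial_boundary x (cis t)) absolutely_integrable_on {0..2 * pi}"
      and coeff: "\<And>n. integral {0..2 * pi} (\<lambda>t. radial_boundary x (cis t) * cnj (cis t ^ n)) = 2 * pi * ((deriv ^^ n) x 0 / fact n)"
      by (rule hardy_2_boundary[OF x]) blast
    have pow: "continuous_on {0..2 * pi} (\<lambda>t. cnj (cis t ^ n))" by (intro continuous_intros)
    have ints: "(\<lambda>t. A (cis t) * cnj (cis t ^ n)) absolutely_integrable_on {0..2 * pi}"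
      "(\<lambda>t. radial_boundary x (cis t) * cnj (cis t ^ n)) absolutely_integrable_on {0..2 * pi}"
      by (intro absolutely_integrable_mult_continuous A int pow)+
    have "disk_restrict (\<lambda>z. z ^ n) \<in> hardy_2"
      by (intro subsetD[OF hardy_inf_subset_hardy_2] disk_restrict_hardy_inf continuous_intros holomorphic_intros)
    from orth[OF this]
    have "0 = (LINT t:{0..2*pi}|lebesgue. (A (cis t) - radial_boundary x (cis t)) * cnj (cis t ^ n))"
      unfolding circle_inner_def by (simp add: radial_boundary_disk_restrict continuous_intros)
    also have "\<dots> = (LINT t:{0..2*pi}|lebesgue. A (cis t) * cnj (cis t ^ n) - radial_boundary x (cis t) * cnj (cis t ^ n))"
      by (simp add: left_diff_distrib)
    also have "\<dots> = integral {0..2 * pi} (\<lambda>t. A (cis t) * cnj (cis t ^ n)) - integral {0..2 * pi} (\<lambda>t. radial_boundary x (cis t) * cnj (cis t ^ n))"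
      using ints by (simp only: set_integral_diff set_lebesgue_integral_eq_integral(2))
    finally show ?thesis unfolding coeff by simp
  qed
  show "h \<in> hardy_2 \<and> (\<forall>k\<in>hardy_2. circle_inner (\<lambda>\<zeta>. A \<zeta> - radial_boundary h \<zeta>) (radial_boundary k) = 0)"
    using h orth by blast
  fix x assume x: "x \<in> hardy_2 \<and> (\<forall>k\<in>hardy_2. circle_inner (\<lambda>\<zeta>. A \<zeta> - radial_boundary x \<zeta>) (radial_boundary k) = 0)"
  have an: "x holomorphic_on unit_disk" "h holomorphic_on unit_disk"
    and out: "\<And>z. z \<notin> unit_disk \<Longrightarrow> x z = 0" "\<And>z. z \<notin> unit_disk \<Longrightarrow> h z = 0"
    using x h by (simp_all add: hardy_2_def disk_analytic_def)
  have eq: "(deriv ^^ n) x 0 / fact n = (deriv ^^ n) h 0 / fact n" for n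
  proof -
    have "2 * pi * ((deriv ^^ n) x 0 / fact n) = 2 * pi * ((deriv ^^ n) h 0 / fact n)"
      using coeff[of x n] coeff[of h n] x h orth by simp
    thus ?thesis by simp
  qed
  show "x = h"
  proof
    fix z show "x z = h z"
    proof (cases "z \<in> unit_disk")
      case True
      show ?thesis using taylor_sums[OF an(1) True] taylor_sums[OF an(2) True] unfolding eq by (rule sums_unique2)
    qed (simp add: out)
  qed
qed

section \<open>Series of Szego kernels\<close>

lemma holomorphic_on_suminf_locally_dominated:
  fixes f :: "nat \<Rightarrow> complex \<Rightarrow> complex"
  assumes A: "open A" and hol: "\<And>n. f n holomorphic_on A"
    and dom: "\<And>x. x \<in> A \<Longrightarrow> \<exists>d>0. cball x d \<subseteq> A \<and> (\<exists>M. summable M \<and> (\<forall>n. \<forall>y\<in>cball x d. cmod (f n y) \<le> M n))"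
  shows "(\<lambda>z. \<Sum>n. f n z) holomorphic_on A"
proof (rule holomorphic_uniform_sequence[OF A, of "\<lambda>n z. \<Sum>i<n. f i z"])
  show "(\<lambda>z. \<Sum>i<n. f i z) holomorphic_on A" for n using hol by (intro holomorphic_intros)
  fix x assume "x \<in> A"
  then obtain d M where "d > 0" "cball x d \<subseteq> A" "summable M" "\<And>n y. y \<in> cball x d \<Longrightarrow> cmod (f n y) \<le> M n"
    using dom by metis
  thus "\<exists>d>0. cball x d \<subseteq> A \<and> uniform_limit (cball x d) (\<lambda>n z. \<Sum>i<n. f i z) (\<lambda>z. \<Sum>n. f n z) sequentially"
    by (intro exI[of _ d] conjI Weierstrass_m_test[of _ _ M]) auto
qed

definition szego_series :: "(nat \<Rightarrow> complex) \<Rightarrow> (nat \<Rightarrow> complex) \<Rightarrow> complex \<Rightarrow> complex"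
  where "szego_series l c z = (\<Sum>n. c n / (1 - cnj (l n) * z))"

text \<open>Poles are required to lie in \<open>S\<close> only for nonzero coefficients, so a term
  can be removed by setting its coefficient to 0. The bound \<open>\<rho>\<close> turns distance
  from a pole into a lower bound for the denominator.\<close>

lemma szego_series_holomorphic:
  assumes c: "summable (\<lambda>n. cmod (c n))" and S: "closed S" "\<And>n. c n \<noteq> 0 \<Longrightarrow> 1 / cnj (l n) \<in> S"
    and l: "\<rho> > 0" "\<And>n. \<rho> \<le> cmod (l n)"
  shows "szego_series l c holomorphic_on - S"
  unfolding szego_series_def
proof (rule holomorphic_on_suminf_locally_dominated)
  have l0: "cnj (l n) \<noteq> 0" for n using l(2)[of n] l(1) by auto
  show "open (- S)" using S by (simp add: open_Compl)
  have fact: "1 - cnj (l n) * z = cnj (l n) * (1 / cnj (l n) - z)" for n z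
    using l0[of n] by (simp add: algebra_simps)
  show "(\<lambda>z. c n / (1 - cnj (l n) * z)) holomorphic_on - S" for n
  proof (cases "c n = 0")
    case False
    hence "1 - cnj (l n) * z \<noteq> 0" if "z \<in> - S" for z
      using S(2)[OF False] that l0[of n] unfolding fact by auto
    thus ?thesis by (intro holomorphic_intros) auto
  qed simp
  fix x assume "x \<in> - S"
  then obtain d where d: "d > 0" "ball x d \<subseteq> - S"
    using S(1) openE[of "- S" x] by (auto simp: open_Compl)
  \<comment> \<open>All relevant poles lie outside \<open>ball x d\<close>, so they stay at distance
    at least \<open>d / 2\<close> from every point within \<open>d / 2\<close> of
    \<open>x\<close>.\<close>
  show "\<exists>d>0. cball x d \<subseteq> - S \<and> (\<exists>M. summable M \<and> (\<forall>n. \<forall>y\<in>cball x d. cmod (c n / (1 - cnj (l n) * y)) \<le> M n))"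
  proof (intro exI[of _ "d / 2"] conjI exI[of _ "\<lambda>n. cmod (c n) / (\<rho> * (d / 2))"] allI ballI)
    show "cball x (d / 2) \<subseteq> - S" using d by (force intro: subset_trans[OF _ d(2)])
    show "summable (\<lambda>n. cmod (c n) / (\<rho> * (d / 2)))" using c by (rule summable_divide)
    fix n y assume y: "y \<in> cball x (d / 2)"
    show "cmod (c n / (1 - cnj (l n) * y)) \<le> cmod (c n) / (\<rho> * (d / 2))"
    proof (cases "c n = 0")
      case False
      have "1 / cnj (l n) \<notin> ball x d" using S(2)[OF False] d(2) by auto
      hence "d \<le> dist x (1 / cnj (l n))" by simp
      also have "\<dots> \<le> dist x y + dist y (1 / cnj (l n))" by (rule dist_triangle)
      finally have "d / 2 \<le> cmod (1 / cnj (l n) - y)" using y by (simp add: dist_norm norm_minus_commute)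
      hence "\<rho> * (d / 2) \<le> cmod (1 - cnj (l n) * y)"
        unfolding fact norm_mult using l d by (intro mult_mono) auto
      thus ?thesis unfolding norm_divide using l(1) d(1) by (intro frac_le) auto
    qed simp
  qed (use d in simp)
qed

text \<open>The kernel at \<open>l\<close> has supremum \<open>1 / (1 - cmod l)\<close> on the
  closed disk, so the hypothesis on \<open>c\<close> is summability of the sup norms of the
  terms.\<close>

lemma szego_series_disk:
  assumes l: "\<And>n. cmod (l n) < 1" and c: "summable (\<lambda>n. cmod (c n) / (1 - cmod (l n)))"
  shows "continuous_on (cball 0 1) (szego_series l c)" "szego_series l c holomorphic_on unit_disk"
    and "\<And>z. cmod z \<le> 1 \<Longrightarrow> (\<lambda>n. c n / (1 - cnj (l n) * z)) sums szego_series l c z"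
proof -
  have bound: "cmod (c n / (1 - cnj (l n) * z)) \<le> cmod (c n) / (1 - cmod (l n))" and nz: "1 - cnj (l n) * z \<noteq> 0"
    if "cmod z \<le> 1" for n z
  proof -
    have 1: "1 - cmod (l n) \<le> cmod (1 - cnj (l n) * z)" "0 < 1 - cmod (l n)"
      using szego_denominator_lower[OF l that] l[of n] by auto
    show "1 - cnj (l n) * z \<noteq> 0" using 1 by auto
    show "cmod (c n / (1 - cnj (l n) * z)) \<le> cmod (c n) / (1 - cmod (l n))"
      unfolding norm_divide by (rule divide_left_mono) (use 1 in \<open>auto intro!: mult_pos_pos\<close>)
  qed
  show "continuous_on (cball 0 1) (szego_series l c)"
    unfolding szego_series_def
    by (rule continuous_on_suminf_dominated[OF _ bound c]) (use nz in \<open>auto intro!: continuous_intros\<close>)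
  show "szego_series l c holomorphic_on unit_disk"
    unfolding szego_series_def
  proof (rule holomorphic_on_suminf_locally_dominated)
    show "(\<lambda>z. c n / (1 - cnj (l n) * z)) holomorphic_on unit_disk" for n
      using nz by (intro holomorphic_intros) auto
    fix x :: complex assume "x \<in> unit_disk"
    then obtain d where d: "d > 0" "cball x d \<subseteq> unit_disk" using open_contains_cball open_ball by metis
    show "\<exists>d>0. cball x d \<subseteq> unit_disk \<and> (\<exists>M. summable M \<and> (\<forall>n. \<forall>y\<in>cball x d. cmod (c n / (1 - cnj (l n) * y)) \<le> M n))"
    proof (intro exI conjI allI ballI)
      fix n y assume "y \<in> cball x d"
      hence "y \<in> unit_disk" using d(2) by blast
      thus "cmod (c n / (1 - cnj (l n) * y)) \<le> cmod (c n) / (1 - cmod (l n))" by (intro bound) simp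
    qed (fact d c)+
  qed simp
  show "(\<lambda>n. c n / (1 - cnj (l n) * z)) sums szego_series l c z" if "cmod z \<le> 1" for z
    unfolding szego_series_def using bound[OF that]
    by (intro summable_sums summable_comparison_test'[OF c, of 0]) auto
qed

text \<open>By the reproducing property the pairing depends on \<open>G\<close> only through the
  values \<open>G (l n)\<close>, so different pairings can be compared term by term.\<close>

lemma integral_szego_series:
  fixes G :: "complex \<Rightarrow> complex"
  assumes l: "\<And>n. cmod (l n) < 1" and c: "summable (\<lambda>n. cmod (c n) / (1 - cmod (l n)))" and G: "G \<in> hardy_2"
  shows "(\<lambda>n. 2 * pi * (cnj (c n) * G (l n))) sums
    integral {0..2 * pi} (\<lambda>t. radial_boundary G (cis t) * cnj (szego_series l c (cis t)))"
proof -
  obtain N where int: "(\<lambda>t. radial_boundary G (cis t)) absolutely_integrable_on {0..2 * pi}"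
    by (rule hardy_2_boundary[OF G]) blast
  define \<phi> where "\<phi> n t = cnj (c n / (1 - cnj (l n) * cis t))" for n t
  have lower: "1 - cmod (l n) \<le> cmod (1 - cnj (l n) * cis t)" "0 < 1 - cmod (l n)" for n t
    using szego_denominator_lower[OF l, where z = "cis t"] l[of n] by auto
  have nz: "1 - cnj (l n) * cis t \<noteq> 0" for n t using lower(1)[of n t] lower(2)[of n] by auto
  have "(\<lambda>n. integral {0..2 * pi} (\<lambda>t. radial_boundary G (cis t) * \<phi> n t)) sums
      integral {0..2 * pi} (\<lambda>t. radial_boundary G (cis t) * (\<Sum>n. \<phi> n t))"
  proof (rule integral_mult_suminf_sums[OF int _ _ c])
    show "continuous_on {0..2 * pi} (\<phi> n)" for n
      unfolding \<phi>_def using nz by (intro continuous_intros) auto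
    show "cmod (\<phi> n t) \<le> cmod (c n) / (1 - cmod (l n))" for n t
      unfolding \<phi>_def complex_mod_cnj norm_divide
      by (rule divide_left_mono) (use lower(1)[of n t] lower(2)[of n] in \<open>auto intro!: mult_pos_pos\<close>)
  qed
  moreover have "(\<Sum>n. \<phi> n t) = cnj (szego_series l c (cis t))" for t
    using sums_cnj[THEN iffD2, OF szego_series_disk(3)[OF l c, where z = "cis t"]]
    unfolding \<phi>_def by (simp add: sums_iff)
  moreover have "integral {0..2 * pi} (\<lambda>t. radial_boundary G (cis t) * \<phi> n t) = 2 * pi * (cnj (c n) * G (l n))" for n
  proof -
    have "integral {0..2 * pi} (\<lambda>t. radial_boundary G (cis t) * \<phi> n t) =
       integral {0..2 * pi} (\<lambda>t. cnj (c n) * (radial_boundary G (cis t) * cnj (1 / (1 - cnj (l n) * cis t))))"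
      unfolding \<phi>_def by (simp add: mult_ac)
    also have "\<dots> = cnj (c n) * (2 * pi * G (l n))"
      unfolding hardy_2_cauchy_formula[OF G l, symmetric] by (rule integral_mult_right)
    finally show ?thesis by simp
  qed
  ultimately show ?thesis by simp
qed

text \<open>The pairing of \<open>a * k\<close> with the series for \<open>c\<close> and that of
  \<open>k\<close> with the series for \<open>d\<close> have the same terms,
  \<open>cnj (c n) * a (l n) * k (l n)\<close> up to the factor \<open>2 * pi\<close>. Their
  difference is the conjugate of the integral that has to vanish.\<close>

lemma toeplitz_szego_series:
  fixes a :: "complex \<Rightarrow> complex"
  assumes l: "\<And>n. cmod (l n) < 1" and c: "summable (\<lambda>n. cmod (c n) / (1 - cmod (l n)))" and a: "a \<in> hardy_inf"
  shows "toeplitz (\<lambda>\<zeta>. cnj (radial_boundary a \<zeta>)) (disk_restrict (szego_series l c))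
    = disk_restrict (szego_series l (\<lambda>n. c n * cnj (a (l n))))"
proof -
  define d where "d n = c n * cnj (a (l n))" for n
  obtain M where M: "\<And>z. z \<in> unit_disk \<Longrightarrow> cmod (a z) \<le> M"
    using a unfolding hardy_inf_def bounded_iff by blast
  have d: "summable (\<lambda>n. cmod (d n) / (1 - cmod (l n)))"
  proof (rule summable_comparison_test'[OF summable_mult[OF c, of M], of 0])
    fix n
    have "cmod (d n) = cmod (a (l n)) * cmod (c n)" by (simp add: d_def norm_mult)
    also have "\<dots> \<le> M * cmod (c n)" using l[of n] by (intro mult_right_mono M) auto
    finally have "cmod (d n) \<le> M * cmod (c n)" .
    hence "cmod (d n) / (1 - cmod (l n)) \<le> M * cmod (c n) / (1 - cmod (l n))"
      using l[of n] by (intro divide_right_mono) auto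
    thus "norm (cmod (d n) / (1 - cmod (l n))) \<le> M * (cmod (c n) / (1 - cmod (l n)))"
      using l[of n] by simp
  qed
  let ?f = "szego_series l c" and ?h = "szego_series l d"
  note cont = szego_series_disk(1)[OF l c] szego_series_disk(1)[OF l d]
  note hol = szego_series_disk(2)[OF l c] szego_series_disk(2)[OF l d]
  have circ: "continuous_on {0..2 * pi} (\<lambda>t. ?f (cis t))" "continuous_on {0..2 * pi} (\<lambda>t. cnj (?f (cis t)))"
     "continuous_on {0..2 * pi} (\<lambda>t. cnj (?h (cis t)))"
    by (rule continuous_on_cnj | rule continuous_on_compose2[OF cont(1)] | rule continuous_on_compose2[OF cont(2)]
        | simp add: image_subset_iff | intro continuous_intros)+
  have rb: "radial_boundary (disk_restrict ?f) (cis t) = ?f (cis t)" "radial_boundary (disk_restrict ?h) (cis t) = ?h (cis t)" for t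
    by (rule radial_boundary_disk_restrict; simp add: cont)+
  have a2: "a \<in> hardy_2" using a hardy_inf_subset_hardy_2 by blast
  obtain Na where Na: "negligible Na"
    "\<And>t. t \<in> {0..2 * pi} - Na \<Longrightarrow> ((\<lambda>r. a (of_real r * cis t)) \<longlongrightarrow> radial_boundary a (cis t)) (at_left (1::real))"
    and aint: "(\<lambda>t. radial_boundary a (cis t)) absolutely_integrable_on {0..2 * pi}"
    by (rule hardy_2_boundary[OF a2]) blast
  have "riesz_projection (\<lambda>\<zeta>. cnj (radial_boundary a \<zeta>) * radial_boundary (disk_restrict ?f) \<zeta>) = disk_restrict ?h"
  proof (rule riesz_projection_eqI)
    show "disk_restrict ?h \<in> hardy_2"
      by (intro subsetD[OF hardy_inf_subset_hardy_2] disk_restrict_hardy_inf cont hol)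
    have "(\<lambda>t. cnj (radial_boundary a (cis t))) absolutely_integrable_on {0..2 * pi}"
      using absolutely_integrable_linear[OF aint bounded_linear_cnj] by (simp add: o_def)
    thus "(\<lambda>t. cnj (radial_boundary a (cis t)) * radial_boundary (disk_restrict ?f) (cis t)) absolutely_integrable_on {0..2 * pi}"
      unfolding rb by (rule absolutely_integrable_mult_continuous[OF _ circ(1)])
    fix k :: "complex \<Rightarrow> complex" assume k: "k \<in> hardy_2"
    have ak: "(\<lambda>z. a z * k z) \<in> hardy_2" by (rule hardy_2_mult[OF a k])
    obtain Nk where Nk: "negligible Nk"
      "\<And>t. t \<in> {0..2 * pi} - Nk \<Longrightarrow> ((\<lambda>r. k (of_real r * cis t)) \<longlongrightarrow> radial_boundary k (cis t)) (at_left (1::real))"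
      and kint: "(\<lambda>t. radial_boundary k (cis t)) absolutely_integrable_on {0..2 * pi}"
      by (rule hardy_2_boundary[OF k]) blast
    obtain N' where akint: "(\<lambda>t. radial_boundary (\<lambda>z. a z * k z) (cis t)) absolutely_integrable_on {0..2 * pi}"
      by (rule hardy_2_boundary[OF ak]) blast
    \<comment> \<open>Off both null sets the radial limits of \<open>a\<close> and \<open>k\<close>
      exist, and only there is the boundary value known to be multiplicative.\<close>
    have prod: "radial_boundary (\<lambda>z. a z * k z) (cis t) = radial_boundary a (cis t) * radial_boundary k (cis t)"
      if "t \<in> {0..2 * pi} - (Na \<union> Nk)" for t
      by (rule radial_boundary_eq) (use that in \<open>intro tendsto_mult Na Nk; blast\<close>)
    \<comment> \<open>\<open>X\<close> is the integrand of the orthogonality relation.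
      \<open>Y\<close> is its conjugate with the two boundary values merged into that of the single
      Hardy function \<open>a * k\<close>, to which \<open>integral_szego_series\<close>
      applies.\<close>
    define Y where "Y t = radial_boundary (\<lambda>z. a z * k z) (cis t) * cnj (?f (cis t)) - radial_boundary k (cis t) * cnj (?h (cis t))" for t
    define X where "X t = (cnj (radial_boundary a (cis t)) * ?f (cis t) - ?h (cis t)) * cnj (radial_boundary k (cis t))" for t
    have ints: "(\<lambda>t. radial_boundary (\<lambda>z. a z * k z) (cis t) * cnj (?f (cis t))) absolutely_integrable_on {0..2 * pi}"
      "(\<lambda>t. radial_boundary k (cis t) * cnj (?h (cis t))) absolutely_integrable_on {0..2 * pi}"
      by (intro absolutely_integrable_mult_continuous akint kint circ)+
    have Yint: "Y absolutely_integrable_on {0..2 * pi}"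
      unfolding Y_def using ints by (rule set_integral_diff)
    have d_at: "cnj (d n) * k (l n) = cnj (c n) * (a (l n) * k (l n))" for n by (simp add: d_def)
    have "integral {0..2 * pi} (\<lambda>t. radial_boundary (\<lambda>z. a z * k z) (cis t) * cnj (?f (cis t)))
        = integral {0..2 * pi} (\<lambda>t. radial_boundary k (cis t) * cnj (?h (cis t)))"
      by (rule sums_unique2[OF integral_szego_series[OF l c ak] integral_szego_series[OF l d k, unfolded d_at]])
    hence Y0: "integral {0..2 * pi} Y = 0"
      unfolding Y_def using ints
      by (subst Henstock_Kurzweil_Integration.integral_diff) (auto intro: set_lebesgue_integral_eq_integral(1))
    have neg: "negligible (Na \<union> Nk)" using Na Nk by (intro negligible_Un)
    have XY: "X t = cnj (Y t)" if "t \<in> {0..2 * pi} - (Na \<union> Nk)" for t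
      unfolding X_def Y_def prod[OF that] by (simp add: algebra_simps)
    have cYint: "(\<lambda>t. cnj (Y t)) absolutely_integrable_on {0..2 * pi}"
      using absolutely_integrable_linear[OF Yint bounded_linear_cnj] by (simp add: o_def)
    have "X absolutely_integrable_on {0..2 * pi}"
      by (rule absolutely_integrable_spike[OF cYint neg XY])
    hence "(LINT t:{0..2*pi}|lebesgue. X t) = integral {0..2 * pi} X"
      by (rule set_lebesgue_integral_eq_integral(2))
    also have "\<dots> = integral {0..2 * pi} (\<lambda>t. cnj (Y t))"
      by (rule integral_spike[OF neg]) (use XY in auto)
    also have "\<dots> = cnj (integral {0..2 * pi} Y)"
      using integral_linear[OF set_lebesgue_integral_eq_integral(1)[OF Yint] bounded_linear_cnj] by (simp add: o_def)
    finally show "circle_inner (\<lambda>\<zeta>. cnj (radial_boundary a \<zeta>) * radial_boundary (disk_restrict ?f) \<zeta> - radial_boundary (disk_restrict ?h) \<zeta>) (radial_boundary k) = 0"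
      unfolding circle_inner_def rb using Y0 by (simp add: X_def)
  qed
  thus ?thesis unfolding toeplitz_def d_def .
qed

section \<open>Poles accumulating at the boundary point\<close>

text \<open>By the identity theorem \<open>a\<close> cannot vanish on a whole terminal segment of
  the radius, so an admissible point exists beyond any given one. Strict monotonicity will make the
  poles distinct.\<close>

lemma nonvanishing_radial_sequence:
  fixes a :: "complex \<Rightarrow> complex"
  assumes hol: "a holomorphic_on unit_disk" and ex: "\<exists>z\<in>unit_disk. a z \<noteq> 0" and \<zeta>: "cmod \<zeta> = 1"
  obtains r :: "nat \<Rightarrow> real" where "strict_mono r" "\<And>n. 1/2 \<le> r n" "\<And>n. r n < 1" "r \<longlonglongrightarrow> 1" "\<And>n. a (of_real (r n) * \<zeta>) \<noteq> 0"
proof -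
  have ex1: "\<exists>x. s < x \<and> x < 1 \<and> a (of_real x * \<zeta>) \<noteq> 0" if s: "0 \<le> s" "s < 1" for s :: real
  proof (rule ccontr)
    assume "\<not> ?thesis"
    hence zero: "\<And>x. s < x \<Longrightarrow> x < 1 \<Longrightarrow> a (of_real x * \<zeta>) = 0" by blast
    define m where "m = (s + 1) / 2"
    have m: "s < m" "m < 1" using s by (auto simp: m_def)
    have "a w = 0" if "w \<in> unit_disk" for w
    proof (rule analytic_continuation[OF hol, of "(\<lambda>x. of_real x * \<zeta>) ` {s<..<1}" "of_real m * \<zeta>"])
      show "of_real m * \<zeta> islimpt (\<lambda>x. of_real x * \<zeta>) ` {s<..<1}"
        unfolding islimpt_sequential
      proof (intro exI[of _ "\<lambda>n. of_real (m + (1 - m) * inverse (real (Suc (Suc n)))) * \<zeta>"] conjI allI)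
        fix n
        define h where "h = (1 - m) * inverse (real (Suc (Suc n)))"
        have "0 < h" using m by (simp add: h_def)
        moreover have "h < (1 - m) * 1"
          unfolding h_def using m by (intro mult_strict_left_mono) (auto simp: field_simps)
        ultimately have "m + h \<in> {s<..<1}" "m + h \<noteq> m" using m by auto
        thus "of_real (m + (1 - m) * inverse (real (Suc (Suc n)))) * \<zeta> \<in> (\<lambda>x. of_real x * \<zeta>) ` {s<..<1} - {of_real m * \<zeta>}"
          unfolding h_def[symmetric] using \<zeta> by (auto simp del: of_real_add)
        next
        have "(\<lambda>n. inverse (real (Suc (Suc n)))) \<longlonglongrightarrow> 0"
          using LIMSEQ_Suc[OF LIMSEQ_inverse_real_of_nat] .
        hence "(\<lambda>n. of_real (m + (1 - m) * inverse (real (Suc (Suc n)))) * \<zeta>) \<longlonglongrightarrow> of_real (m + (1 - m) * 0) * \<zeta>"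
          by (intro tendsto_intros)
        thus "(\<lambda>n. of_real (m + (1 - m) * inverse (real (Suc (Suc n)))) * \<zeta>) \<longlonglongrightarrow> of_real m * \<zeta>" by simp
      qed
    qed (use that s m zero \<zeta> in \<open>auto simp: norm_mult\<close>)
    thus False using ex by blast
  qed
  \<comment> \<open>The lower bound equals 1/2 at \<open>n = 0\<close> and tends to 1. The uniform
    bound 1/2 on the radii later serves as \<open>\<rho>\<close> in
    \<open>szego_series_holomorphic\<close>.\<close>
  define P where "P n x \<longleftrightarrow> 1 - inverse (real (Suc (Suc n))) < x \<and> x < 1 \<and> a (of_real x * \<zeta>) \<noteq> 0" for n x
  have "\<exists>r. \<forall>n. P n (r n) \<and> r n < r (Suc n)"
  proof (rule dependent_nat_choice)
    show "\<exists>x. P 0 x" unfolding P_def by (rule ex1) auto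
    fix x n assume "P n x"
    hence "max x (1 - inverse (real (Suc (Suc (Suc n))))) < 1" "0 \<le> max x (1 - inverse (real (Suc (Suc (Suc n)))))"
      by (auto simp: P_def field_simps le_max_iff_disj)
    from ex1[OF this(2,1)] show "\<exists>y. P (Suc n) y \<and> x < y" unfolding P_def by auto
  qed
  then obtain r where r: "\<And>n. P n (r n)" "\<And>n. r n < r (Suc n)" by blast
  show ?thesis
  proof (rule that)
    show "strict_mono r" using r by (simp add: strict_mono_Suc_iff)
    show "r n < 1" "a (of_real (r n) * \<zeta>) \<noteq> 0" for n using r(1)[of n] by (auto simp: P_def)
    show "1/2 \<le> r n" for n
    proof -
      have "inverse (real (Suc (Suc n))) \<le> 1/2" by (simp add: field_simps)
      thus ?thesis using r(1)[of n] by (simp add: P_def)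
    qed
    have "(\<lambda>n. 1 - inverse (real (Suc (Suc n)))) \<longlonglongrightarrow> 1 - 0"
      by (intro tendsto_intros LIMSEQ_Suc[OF LIMSEQ_inverse_real_of_nat])
    thus "r \<longlonglongrightarrow> 1"
      by (intro tendsto_sandwich[of _ r _ "\<lambda>_. 1"])
         (use r(1) in \<open>auto simp: P_def intro!: always_eventually less_imp_le\<close>)
  qed
qed

text \<open>A continuation \<open>F\<close> reaches some pole \<open>p N\<close> close to
  \<open>\<zeta>\<close>. Without its \<open>N\<close>-th term the series is holomorphic at
  \<open>p N\<close>, so \<open>F\<close> minus the remaining series would continue
  \<open>d N / (1 - cnj (l N) * z)\<close> holomorphically to the pole of that very term, which
  forces \<open>d N = 0\<close>.\<close>

lemma szego_series_no_continuation:
  assumes \<zeta>: "cmod \<zeta> = 1" and inj: "inj r" and r: "\<And>n. 1/2 \<le> r n" "\<And>n. r n < 1" "r \<longlonglongrightarrow> 1"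
    and d: "summable (\<lambda>n. cmod (d n))" "summable (\<lambda>n. cmod (d n) / (1 - r n))" "\<And>n. d n \<noteq> 0"
  shows "\<not> continues_analytically_near (disk_restrict (szego_series (\<lambda>n. of_real (r n) * \<zeta>) d)) \<zeta>"
proof
  define l where "l n = of_real (r n) * \<zeta>" for n
  have lnorm: "cmod (l n) = r n" for n using \<zeta> r(1)[of n] by (simp add: l_def norm_mult)
  assume "continues_analytically_near (disk_restrict (szego_series (\<lambda>n. of_real (r n) * \<zeta>) d)) \<zeta>"
  then obtain U F where U: "open U" "\<zeta> \<in> U" and F: "F holomorphic_on U"
    "\<And>z. z \<in> U \<Longrightarrow> z \<in> unit_disk \<Longrightarrow> F z = szego_series l d z"
    unfolding continues_analytically_near_def l_def[abs_def] disk_restrict_def by auto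
  obtain e where e: "e > 0" "ball \<zeta> e \<subseteq> U" using U openE by blast
  define p where "p n = \<zeta> / of_real (r n)" for n
  have r0: "0 < r n" for n using r(1)[of n] by simp
  have z0: "\<zeta> \<noteq> 0" using \<zeta> by auto
  have \<zeta>\<zeta>: "\<zeta> * cnj \<zeta> = 1" using \<zeta> by (simp add: complex_norm_square[symmetric])
  have pl: "1 / cnj (l n) = p n" for n
    using r0[of n] \<zeta>\<zeta> z0 by (simp add: l_def p_def field_simps)
  have pnorm: "cmod (p n) > 1" for n using \<zeta> r0[of n] r(2)[of n] by (simp add: p_def norm_divide)
  have plim: "p \<longlonglongrightarrow> \<zeta>"
    unfolding p_def using tendsto_divide[OF tendsto_const tendsto_of_real[OF r(3)], of \<zeta>] by simp
  then obtain N where N: "p N \<in> ball \<zeta> e"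
    using e(1) by (metis LIMSEQ_iff dist_norm mem_ball norm_minus_commute order_refl)
  \<comment> \<open>Overwriting the \<open>N\<close>-th entry by the limit removes
    \<open>p N\<close> from the set but keeps a convergent sequence, so \<open>S\<close> is still
    compact.\<close>
  define q where "q n = (if n = N then \<zeta> else p n)" for n
  define S where "S = insert \<zeta> (range q)"
  have "q \<longlonglongrightarrow> \<zeta>"
  proof (rule Lim_transform_eventually[OF plim])
    show "\<forall>\<^sub>F n in sequentially. p n = q n"
      using eventually_gt_at_top[of N] by eventually_elim (simp add: q_def)
  qed
  hence S: "closed S" unfolding S_def by (intro compact_imp_closed compact_sequence_with_limit)
  have Sout: "S \<inter> unit_disk = {}"
  proof -
    have "1 \<le> cmod (q n)" for n using \<zeta> pnorm[of n] by (simp add: q_def)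
    thus ?thesis using \<zeta> by (auto simp: S_def not_less[symmetric])
  qed
  have pNS: "p N \<notin> S"
  proof -
    have "p N \<noteq> \<zeta>" using pnorm[of N] \<zeta> by auto
    moreover have "p N \<noteq> p n" if "n \<noteq> N" for n
    proof
      assume "p N = p n"
      hence "of_real (r N) = (of_real (r n) :: complex)" using z0 r0[of n] r0[of N] by (simp add: p_def field_simps)
      thus False using inj that by (auto dest: injD)
    qed
    ultimately show ?thesis by (auto simp: S_def q_def)
  qed
  define d' where "d' n = (if n = N then 0 else d n)" for n
  have H: "szego_series l d' holomorphic_on - S"
  proof (rule szego_series_holomorphic[OF _ S])
    show "summable (\<lambda>n. cmod (d' n))"
      by (rule summable_comparison_test'[OF d(1), of 0]) (simp add: d'_def)
    show "1 / cnj (l n) \<in> S" if "d' n \<noteq> 0" for n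
      using that unfolding pl by (auto simp: d'_def S_def q_def split: if_splits intro!: image_eqI[of _ _ n])
    show "(0::real) < 1/2" by simp
    show "1/2 \<le> cmod (l n)" for n using r lnorm by simp
  qed
  define V where "V = ball \<zeta> e - S"
  have V: "open V" unfolding V_def using S by (intro open_Diff) auto
  \<comment> \<open>The poles cluster in the middle of the ball. Deleting a countable set does not
    disconnect it, so \<open>V\<close> still joins the part inside the disk to
    \<open>p N\<close>.\<close>
  have Vc: "connected V" unfolding V_def
    by (rule connected_open_diff_countable) (auto simp: S_def)
  have split: "szego_series l d z = szego_series l d' z + d N / (1 - cnj (l N) * z)" if "z \<in> unit_disk" for z
  proof -
    have "(\<lambda>n. d n / (1 - cnj (l n) * z)) sums szego_series l d z"
      by (rule szego_series_disk(3)) (use d r lnorm that in auto)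
    from sums_diff[OF this sums_single[of N "\<lambda>n. d n / (1 - cnj (l n) * z)"]]
    have "(\<lambda>n. d' n / (1 - cnj (l n) * z)) sums (szego_series l d z - d N / (1 - cnj (l N) * z))"
      by (rule sums_cong[THEN iffD1, rotated]) (simp add: d'_def)
    thus ?thesis unfolding szego_series_def by (simp add: sums_iff)
  qed
  \<comment> \<open>The first factor clears the pole: on the disk the product is constantly
    \<open>d N\<close>, while at \<open>p N\<close> that factor is 0.\<close>
  have "(1 - cnj (l N) * p N) * (F (p N) - szego_series l d' (p N)) = d N"
  proof (rule analytic_continuation_open[where s = "V \<inter> unit_disk" and s' = V and z = "p N"])
    \<comment> \<open>A point on the radius within \<open>e\<close> of \<open>\<zeta>\<close>; the
      maximum with 0 covers the case \<open>e > 2\<close>.\<close>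
    have "of_real (max 0 (1 - e / 2)) * \<zeta> \<in> ball \<zeta> e \<inter> unit_disk"
    proof -
      have "\<zeta> - of_real (max 0 (1 - e / 2)) * \<zeta> = of_real (1 - max 0 (1 - e / 2)) * \<zeta>" by (simp add: algebra_simps)
      hence "dist \<zeta> (of_real (max 0 (1 - e / 2)) * \<zeta>) = \<bar>1 - max 0 (1 - e / 2)\<bar>"
        unfolding dist_norm using \<zeta> by (simp only: norm_mult norm_of_real mult_1_right)
      thus ?thesis using e(1) \<zeta> by (auto simp: norm_mult max_def)
    qed
    thus "V \<inter> unit_disk \<noteq> {}" using Sout unfolding V_def by blast
    show "(\<lambda>z. (1 - cnj (l N) * z) * (F z - szego_series l d' z)) holomorphic_on V"
      by (intro holomorphic_intros holomorphic_on_subset[OF F(1)] holomorphic_on_subset[OF H]) (use e in \<open>auto simp: V_def\<close>)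
    show "p N \<in> V" using N pNS by (simp add: V_def)
    fix z assume z: "z \<in> V \<inter> unit_disk"
    have "1 - cnj (l N) * z \<noteq> 0"
      using szego_denominator_lower[of "l N" z] z r(2)[of N] lnorm[of N] by auto
    thus "(1 - cnj (l N) * z) * (F z - szego_series l d' z) = d N"
      using F(2)[of z] z e split[of z] by (auto simp: V_def)
  qed (use V Vc in auto)
  moreover have "1 - cnj (l N) * p N = 0" unfolding pl[symmetric] using r0[of N] z0 by (simp add: l_def)
  ultimately show False using d(3) by simp
qed

theorem proposition4p17:
  fixes a :: "complex \<Rightarrow> complex"
  assumes "a \<in> hardy_inf" and "\<exists>z\<in>unit_disk. a z \<noteq> 0"
  shows "\<not> (\<exists>\<zeta>\<^sub>0\<in>sphere 0 1. \<forall>f\<in>toeplitz_range (\<lambda>\<zeta>. cnj (radial_boundary a \<zeta>)).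
           continues_analytically_near f \<zeta>\<^sub>0)"
proof
  assume "\<exists>\<zeta>\<^sub>0\<in>sphere 0 1. \<forall>f\<in>toeplitz_range (\<lambda>\<zeta>. cnj (radial_boundary a \<zeta>)). continues_analytically_near f \<zeta>\<^sub>0"
  then obtain \<zeta> where \<zeta>: "cmod \<zeta> = 1"
    and cont: "\<And>f. f \<in> toeplitz_range (\<lambda>\<zeta>. cnj (radial_boundary a \<zeta>)) \<Longrightarrow> continues_analytically_near f \<zeta>"
    by auto
  have hol: "a holomorphic_on unit_disk" using assms(1) by (simp add: hardy_inf_def disk_analytic_def)
  obtain M where M: "\<And>z. z \<in> unit_disk \<Longrightarrow> cmod (a z) \<le> M"
    using assms(1) unfolding hardy_inf_def bounded_iff by blast
  obtain r where r: "strict_mono r" "\<And>n. 1/2 \<le> r n" "\<And>n. r n < 1" "r \<longlonglongrightarrow> 1" "\<And>n. a (of_real (r n) * \<zeta>) \<noteq> 0"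
    using nonvanishing_radial_sequence[OF hol assms(2) \<zeta>] by metis
  define l where "l n = of_real (r n) * \<zeta>" for n
  have lnorm: "cmod (l n) = r n" for n using \<zeta> r(2)[of n] by (simp add: l_def norm_mult)
  have l1: "cmod (l n) < 1" for n using r(3) lnorm by simp
  \<comment> \<open>The factor \<open>1 - r n\<close> compensates the supremum of the kernel on the
    closed disk, so the terms have geometrically decaying sup norms.\<close>
  define c where "c n = complex_of_real ((1 - r n) * (1/2) ^ n)" for n
  have cnorm: "cmod (c n) = (1 - r n) * (1/2) ^ n" for n
    unfolding c_def norm_of_real using r(3)[of n] by simp
  have cq: "cmod (c n) / (1 - cmod (l n)) = (1/2) ^ n" for n
    unfolding cnorm lnorm using r(3)[of n] by simp
  have csum: "summable (\<lambda>n. cmod (c n) / (1 - cmod (l n)))"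
    unfolding cq by (intro summable_geometric) simp
  define d where "d n = c n * cnj (a (l n))" for n
  have geo: "summable (\<lambda>n. M * (1/2::real) ^ n)" by (intro summable_mult summable_geometric) simp
  have dq: "cmod (d n) / (1 - r n) \<le> M * (1/2) ^ n" for n
  proof -
    have "cmod (d n) / (1 - r n) = (1/2) ^ n * cmod (a (l n))"
      unfolding d_def norm_mult cnorm complex_mod_cnj using r(3)[of n] by simp
    also have "\<dots> \<le> (1/2) ^ n * M" using M[of "l n"] l1[of n] by (intro mult_left_mono) auto
    finally show ?thesis by (simp add: mult.commute)
  qed
  have dsum: "summable (\<lambda>n. cmod (d n) / (1 - r n))"
    by (rule summable_comparison_test'[OF geo, of 0]) (use dq r(3) in \<open>simp add: less_imp_le\<close>)
  have "cmod (d n) \<le> cmod (d n) / (1 - r n)" for n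
    using r(2)[of n] r(3)[of n] by (simp add: field_simps mult_left_le)
  hence dsum': "summable (\<lambda>n. cmod (d n))" by (intro summable_comparison_test'[OF dsum, of 0]) auto
  have "disk_restrict (szego_series l c) \<in> hardy_2"
    by (intro subsetD[OF hardy_inf_subset_hardy_2] disk_restrict_hardy_inf szego_series_disk l1 csum)
  hence "toeplitz (\<lambda>\<zeta>. cnj (radial_boundary a \<zeta>)) (disk_restrict (szego_series l c)) \<in> toeplitz_range (\<lambda>\<zeta>. cnj (radial_boundary a \<zeta>))"
    unfolding toeplitz_range_def by blast
  hence "disk_restrict (szego_series l d) \<in> toeplitz_range (\<lambda>\<zeta>. cnj (radial_boundary a \<zeta>))"
    unfolding toeplitz_szego_series[OF l1 csum assms(1)] d_def .
  hence "continues_analytically_near (disk_restrict (szego_series l d)) \<zeta>" by (rule cont)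
  moreover have "\<not> continues_analytically_near (disk_restrict (szego_series l d)) \<zeta>"
    unfolding l_def[abs_def]
  proof (rule szego_series_no_continuation[OF \<zeta> strict_mono_imp_inj_on[OF r(1)] r(2,3,4) dsum' dsum])
    show "d n \<noteq> 0" for n using r(3)[of n] r(5)[of n] by (simp add: d_def c_def l_def)
  qed
  ultimately show False by contradiction
qed

end
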